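(* Let $\preceq_{\mathbb Q}$ be the quasi-order on ${}^{\mathbb Q}\omega$ defined by $c\preceq_{\mathbb Q}c'$ iff there is an order embedding $g\colon(\mathbb Q,<)\to(\mathbb Q,<)$ with $c(q)=c'(g(q))$ for all $q\in\mathbb Q$, and let $\cong_{\mathbb Q}$ be the equivalence relation $c\cong_{\mathbb Q}c'$ iff there is an order automorphism $h$ of $\mathbb Q$ with $c(q)=c'(h(q))$ for all $q$. Then the pair $(\preceq_{\mathbb Q},\cong_{\mathbb Q})$ is invariantly universal.
   Context: Borel reducibility: for binary relations $R,R'$ on standard Borel spaces $X,X'$, a Borel $h\colon X\to X'$ with $x\,R\,y \iff h(x)\,R'\,h(y)$ is a Borel reduction, written $R\le_B R'$; $R\sim_B R'$ means $R\le_B R'\le_B R$. For an analytic quasi-order $S$ on a standard Borel space $X$ and an analytic equivalence relation $E\subseteq S\cap S^{-1}$ on $X$, the pair $(S,E)$ is invariantly universal if for every analytic quasi-order $R$ on a standard Borel space there is a Borel $E$-invariant $B\subseteq X$ with $R\sim_B S\restriction B$. *)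

theory Defs
  imports "HOL-Analysis.Analysis"
begin

section \<open>Standard Borel spaces and analytic sets\<close>

text \<open>
  A standard Borel space is a measurable space whose \<open>\<sigma>\<close>-algebra is the Borel
  algebra of some Polish topology on it.  The type of measures is used only as the type of
  measurable spaces; the measure itself plays no role.
\<close>

definition standard_borel :: "'a measure \<Rightarrow> bool" where
  "standard_borel M \<longleftrightarrow>
     (\<exists>T. completely_metrizable_space T \<and> second_countable T \<and> topspace T = space M \<and>
          sets M = sigma_sets (space M) {U. openin T U})"

text \<open>
  Analytic sets are the projections of Borel subsets of the product of the space with Baire
  space \<^typ>\<open>nat \<Rightarrow> nat\<close> (whose topology in the library is the product of
  discrete topologies).
\<close>

definition analytic_in :: "'a measure \<Rightarrow> 'a set \<Rightarrow> bool" where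
  "analytic_in M A \<longleftrightarrow>
     (\<exists>B \<in> sets (M \<Otimes>\<^sub>M (borel :: (nat \<Rightarrow> nat) measure)). A = fst ` B)"

definition analytic_quasi_order :: "'a measure \<Rightarrow> 'a rel \<Rightarrow> bool" where
  "analytic_quasi_order M R \<longleftrightarrow> preorder_on (space M) R \<and> analytic_in (M \<Otimes>\<^sub>M M) R"

definition analytic_equivalence :: "'a measure \<Rightarrow> 'a rel \<Rightarrow> bool" where
  "analytic_equivalence M E \<longleftrightarrow> equiv (space M) E \<and> analytic_in (M \<Otimes>\<^sub>M M) E"


section \<open>Borel reducibility and invariant universality\<close>

definition borel_reducible :: "'a measure \<Rightarrow> 'a rel \<Rightarrow> 'b measure \<Rightarrow> 'b rel \<Rightarrow> bool" where
  "borel_reducible M R N S \<longleftrightarrow>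
     (\<exists>h \<in> measurable M N. \<forall>x\<in>space M. \<forall>y\<in>space M. (x, y) \<in> R \<longleftrightarrow> (h x, h y) \<in> S)"

definition borel_bireducible :: "'a measure \<Rightarrow> 'a rel \<Rightarrow> 'b measure \<Rightarrow> 'b rel \<Rightarrow> bool" where
  "borel_bireducible M R N S \<longleftrightarrow> borel_reducible M R N S \<and> borel_reducible N S M R"

definition invariant_under :: "'a rel \<Rightarrow> 'a set \<Rightarrow> bool" where
  "invariant_under E B \<longleftrightarrow> (\<forall>x y. x \<in> B \<longrightarrow> (x, y) \<in> E \<longrightarrow> y \<in> B)"

text \<open>
  HOL cannot quantify over types inside a formula, so the carrier type \<^typ>\<open>'b\<close> of the
  arbitrary analytic quasi-order is a parameter.  A theorem
  \<open>invariantly_universal TYPE('b) M S E\<close> with \<^typ>\<open>'b\<close> a free type variable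
  ranges over all standard Borel spaces of all types.  The standing requirements on
  \<open>(S, E)\<close> are part of the definition.
\<close>

definition invariantly_universal :: "'b itself \<Rightarrow> 'a measure \<Rightarrow> 'a rel \<Rightarrow> 'a rel \<Rightarrow> bool" where
  "invariantly_universal _ M S E \<longleftrightarrow>
     standard_borel M \<and> analytic_quasi_order M S \<and> analytic_equivalence M E \<and> E \<subseteq> S \<inter> S\<inverse> \<and>
     (\<forall>(N :: 'b measure) R. standard_borel N \<longrightarrow> analytic_quasi_order N R \<longrightarrow>
        (\<exists>B \<in> sets M. invariant_under E B \<and>
           borel_bireducible N R (restrict_space M B) (S \<inter> B \<times> B)))"


section \<open>Colourings of the rationals\<close>

text \<open>
  On linear orders, order embeddings are exactly the strictly increasing maps
  (\<open>strict_mono_less\<close>), and order automorphisms the strictly increasing bijections.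
\<close>

definition rat_coloring_embed :: "(rat \<Rightarrow> nat) rel" where
  "rat_coloring_embed =
     {(c, c'). \<exists>g :: rat \<Rightarrow> rat. strict_mono g \<and> (\<forall>q. c q = c' (g q))}"

definition rat_coloring_iso :: "(rat \<Rightarrow> nat) rel" where
  "rat_coloring_iso =
     {(c, c'). \<exists>h :: rat \<Rightarrow> rat. bij h \<and> strict_mono h \<and> (\<forall>q. c q = c' (h q))}"

end

theory Submission
  imports Defs "HOL-Library.List_Lexorder"
begin

text \<open>
  Let \<open>R\<close> be the projection of a closed set.  Following Louveau and Rosendal, \<open>R\<close> is
  written as \<open>x R y \<longleftrightarrow> (\<exists>\<beta>. \<forall>n. linked n x y \<beta>)\<close>, where the finite approximations are reflexive,
  transitive up to adding the witnesses \<open>\<beta>\<close>, and insensitive to enlarging \<open>\<beta>\<close>; transitivity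
  is forced by passing to chains of length \<open>\<beta> 0\<close>, and compactness recovers
  \<open>R\<close>.

  The colouring attached to \<open>x\<close> partitions \<open>\<rat>\<close> into intervals, called blocks, indexed by
  the finite sequences \<open>\<sigma>\<close> of naturals in lexicographic order; in the block of \<open>\<sigma>\<close> a set of
  colours depending on \<open>\<sigma>\<close> and \<open>x\<close> is dense.  Colours of blocks of different length are
  distinct, and the colour sets grow with \<open>\<sigma>\<close>.  If \<open>x R y\<close> is witnessed by \<open>\<beta>\<close>, the block of
  \<open>\<sigma>\<close> can be mapped into the block of \<open>\<sigma> + \<beta>\<close>.  Conversely, consider the
  image under an embedding of the region of \<open>\<sigma>\<close>, formed by the blocks properly extending \<open>\<sigma>\<close>: it is
  bounded by the image of the next block of the same length, so it meets only finitely many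
  regions of that level and its final part lies in a single one; iterating this yields \<open>\<beta>\<close>.

  Further colours mark all \<open>\<tau> \<le> \<sigma>\<close> in the block of \<open>\<sigma>\<close>.  They do not obstruct the embeddings
  but make the block of a rational, and hence \<open>x\<close>, readable from the colours immediately to its
  right.  So the set of all colourings of this kind is Borel, it is invariant, and \<open>x\<close> is a
  Borel function of the colouring.
\<close>

section \<open>Blocks and embeddings\<close>

definition realizes :: "(rat \<Rightarrow> nat) \<Rightarrow> (nat list \<Rightarrow> nat set) \<Rightarrow> (rat \<Rightarrow> nat list) \<Rightarrow> bool" where
  "realizes c A b \<longleftrightarrow>
     mono b \<and> surj b \<and> (\<forall>q. c q \<in> A (b q)) \<and> (\<forall>q. \<exists>r>q. b r = b q) \<and>
     (\<forall>p r. p < r \<longrightarrow> b p = b r \<longrightarrow> (\<forall>k\<in>A (b p). \<exists>t. p < t \<and> t < r \<and> c t = k))"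

lemma realizes_dense:
  assumes "realizes c A b" "p < r" "b p = b r" "k \<in> A (b p)"
  obtains t where "p < t" "t < r" "c t = k"
  using assms unfolding realizes_def by blast

lemma finite_to_nat_less: "finite {r :: 'a::countable. to_nat r < n}"
  by (rule inj_on_finite[of to_nat _ "{..<n}"]) auto

lemma embed_of_realizes:
  assumes c: "realizes c A b" and c': "realizes c' A' b'"
    and f: "strict_mono f" and sub: "\<And>\<sigma>. A \<sigma> \<subseteq> A' (f \<sigma>)"
  shows "(c, c') \<in> rat_coloring_embed"
proof -
  have mb: "mono b" and mb': "mono b'" using c c' by (auto simp: realizes_def)
  have "\<exists>p r. p < r \<and> b' p = \<sigma> \<and> b' r = \<sigma>" for \<sigma>
    using c' unfolding realizes_def surj_def by metis
  then obtain l u where lu: "\<And>\<sigma>. l \<sigma> < u \<sigma>" "\<And>\<sigma>. b' (l \<sigma>) = \<sigma>" "\<And>\<sigma>. b' (u \<sigma>) = \<sigma>"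
    by metis
  define F where "F q = f (b q)" for q
  have sep: "u (F r) < l (F q)" if "r < q" "F r \<noteq> F q" for r q
  proof -
    have "b r < b q" using that mb by (metis F_def monoD less_imp_le order_le_imp_less_or_eq)
    then have "F r < F q" using f by (simp add: F_def strict_mono_less)
    then show ?thesis using mb' lu by (metis monoD leD not_less)
  qed
  have dense: "\<exists>t. x < t \<and> t < y \<and> c' t = c q"
    if "l (F q) \<le> x" "x < y" "y \<le> u (F q)" for x y q
  proof -
    have "b' (l (F q)) \<le> b' x" "b' x \<le> b' y" "b' y \<le> b' (u (F q))"
      using that by (auto intro!: monoD[OF mb'])
    then have "b' x = F q" "b' y = F q" using lu(2,3)[of "F q"] by auto
    moreover have "c q \<in> A' (F q)" using c sub[of "b q"] by (auto simp: realizes_def F_def)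
    ultimately show ?thesis using c' that(2) by (auto simp: realizes_def)
  qed
  define P where "P g q p \<longleftrightarrow> l (F q) < p \<and> p < u (F q) \<and> c' p = c q \<and>
      (\<forall>r. to_nat r < to_nat q \<longrightarrow> (r < q \<longrightarrow> g r < p) \<and> (q < r \<longrightarrow> p < g r))"
    for g :: "rat \<Rightarrow> rat" and q p
  have "\<exists>g. \<forall>q. P g q (g q)"
  proof (rule dependent_wf_choice[of "Wellfounded.measure to_nat"])
    fix g h :: "rat \<Rightarrow> rat" and q p
    assume "\<And>z. (z, q) \<in> Wellfounded.measure to_nat \<Longrightarrow> g z = h z"
    then show "P g q p = P h q p" by (auto simp: P_def)
  next
    fix q :: rat and g :: "rat \<Rightarrow> rat"
    assume IH: "\<And>y. (y, q) \<in> Wellfounded.measure to_nat \<Longrightarrow> P g y (g y)"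
    define L where "L = insert (l (F q)) (g ` {r. to_nat r < to_nat q \<and> r < q \<and> F r = F q})"
    define U where "U = insert (u (F q)) (g ` {r. to_nat r < to_nat q \<and> q < r \<and> F r = F q})"
    have fin: "finite L" "finite U" unfolding L_def U_def
      by (auto intro!: finite_imageI intro: finite_subset[OF _ finite_to_nat_less])
    have P: "P g r (g r)" if "to_nat r < to_nat q" for r using IH that by simp
    have "x < y" if "x \<in> L" "y \<in> U" for x y
    proof -
      have "g r < g s" if "to_nat r < to_nat q" "r < q" "to_nat s < to_nat q" "q < s" for r s
      proof (cases "to_nat r < to_nat s")
        case True
        then show ?thesis using P[OF that(3)] that by (auto simp: P_def)
      next
        case False
        moreover have "r \<noteq> s" using that by auto
        then have "to_nat r \<noteq> to_nat s" by simp
        ultimately have "to_nat s < to_nat r" by linarith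
        then show ?thesis using P[OF that(1)] that by (auto simp: P_def)
      qed
      then show ?thesis using that lu(1) P by (force simp: L_def U_def P_def)
    qed
    then have "Max L < Min U" using fin
      by (metis L_def U_def Max_in Min_in insert_not_empty)
    moreover have "l (F q) \<le> Max L" "Min U \<le> u (F q)" using fin
      by (auto simp: L_def U_def)
    ultimately obtain p where p: "Max L < p" "p < Min U" "c' p = c q"
      using dense by blast
    have pL: "x < p" if "x \<in> L" for x using p(1) fin that by (meson Max_ge le_less_trans)
    have pU: "p < x" if "x \<in> U" for x using p(2) fin that by (meson Min_le less_le_trans)
    have "g r < p" if "to_nat r < to_nat q" "r < q" for r
    proof (cases "F r = F q")
      case False
      then have "g r < l (F q)" using sep[OF that(2)] P[OF that(1)] by (auto simp: P_def)
      then show ?thesis using pL[of "l (F q)"] by (auto simp: L_def)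
    qed (use that in \<open>auto intro!: pL simp: L_def\<close>)
    moreover have "p < g r" if "to_nat r < to_nat q" "q < r" for r
    proof (cases "F r = F q")
      case False
      then have "u (F q) < g r" using sep[OF that(2)] P[OF that(1)] by (auto simp: P_def)
      then show ?thesis using pU[of "u (F q)"] by (auto simp: U_def)
    qed (use that in \<open>auto intro!: pU simp: U_def\<close>)
    ultimately have "P g q p" using p(3) pL[of "l (F q)"] pU[of "u (F q)"]
      by (auto simp: P_def L_def U_def)
    then show "\<exists>p. P g q p" ..
  qed auto
  then obtain g where g: "\<And>q. P g q (g q)" by auto
  have "strict_mono g"
  proof (rule strict_monoI)
    fix q r :: rat assume "q < r"
    then have "to_nat q \<noteq> to_nat r" by simp
    then have "to_nat q < to_nat r \<or> to_nat r < to_nat q" by linarith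
    then show "g q < g r" using g[of q] g[of r] \<open>q < r\<close> by (auto simp: P_def)
  qed
  moreover have "c q = c' (g q)" for q using g[of q] by (auto simp: P_def)
  ultimately show ?thesis by (auto simp: rat_coloring_embed_def)
qed

lemma append_Cons_le_append_Cons:
  fixes \<sigma> \<tau> :: "'a::linorder list"
  assumes "\<sigma> @ i # \<rho> \<le> \<sigma> @ j # \<tau>" shows "i \<le> j"
  using assms by (induction \<sigma>) auto

lemma append_strict_mono_lex: "\<sigma> @ \<rho> < \<sigma> @ \<tau> \<longleftrightarrow> \<rho> < \<tau>" for \<sigma> :: "'a::linorder list"
  by (induction \<sigma>) auto

lemma branch_of_embed:
  assumes c: "realizes c A b" and c': "realizes c' A' b'"
    and lev: "\<And>k \<sigma> \<tau>. k \<in> A \<sigma> \<Longrightarrow> k \<in> A' \<tau> \<Longrightarrow> length \<sigma> = length \<tau>"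
    and monA: "\<And>\<sigma> \<tau>. list_all2 (\<le>) \<sigma> \<tau> \<Longrightarrow> A \<sigma> \<subseteq> A \<tau>"
    and monA': "\<And>\<sigma> \<tau>. list_all2 (\<le>) \<sigma> \<tau> \<Longrightarrow> A' \<sigma> \<subseteq> A' \<tau>"
    and emb: "(c, c') \<in> rat_coloring_embed"
  shows "\<exists>\<beta>. \<forall>n>0. A (replicate n 0) \<subseteq> A' (map \<beta> [0..<n])"
proof -
  from emb obtain g where g: "strict_mono g" "\<And>q. c q = c' (g q)"
    by (auto simp: rat_coloring_embed_def)
  have mb: "mono b" and mb': "mono b'" and sb: "surj b"
    and bA: "\<And>q. c q \<in> A (b q)" and bA': "\<And>q. c' q \<in> A' (b' q)"
    using c c' by (auto simp: realizes_def)
  have len: "length (b' (g q)) = length (b q)" for q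
    using lev[OF bA[of q], of "b' (g q)"] bA'[of "g q"] g(2)[of q] by simp
  have less: "p < q" if "b p < b q" for p q using mb that by (metis monoD leD not_less)
  have le': "b' (g p) \<le> b' (g q)" if "p \<le> q" for p q
    using mb' g(1) that by (meson monoD strict_mono_less_eq)
  \<comment> \<open>\<open>Good \<sigma> \<sigma>'\<close>: a final part of the region of \<open>\<sigma>\<close> (the blocks properly extending \<open>\<sigma>\<close>) is
    mapped into the region of \<open>\<sigma>'\<close>.\<close>
  define Good where "Good \<sigma> \<sigma>' \<longleftrightarrow> length \<sigma> = length \<sigma>' \<and>
     (\<exists>m. \<forall>q i \<rho>. m \<le> i \<longrightarrow> b q = \<sigma> @ i # \<rho> \<longrightarrow> (\<exists>\<rho>'. b' (g q) = \<sigma>' @ \<rho>'))" for \<sigma> \<sigma>'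
  have step: "\<exists>i j. Good (\<sigma> @ [i]) (\<sigma>' @ [j]) \<and> A (\<sigma> @ [i]) \<subseteq> A' (\<sigma>' @ [j])"
    if G: "Good \<sigma> \<sigma>'" for \<sigma> \<sigma>'
  proof -
    from G have ll: "length \<sigma> = length \<sigma>'" by (auto simp: Good_def)
    from G obtain m where m0: "\<forall>q i \<rho>. m \<le> i \<longrightarrow> b q = \<sigma> @ i # \<rho> \<longrightarrow> (\<exists>\<rho>'. b' (g q) = \<sigma>' @ \<rho>')"
      by (auto simp: Good_def)
    then have m: "\<exists>j \<rho>'. b' (g q) = \<sigma>' @ j # \<rho>' \<and> length \<rho>' = length \<rho>"
      if iq: "m \<le> i" "b q = \<sigma> @ i # \<rho>" for q i \<rho>
    proof -
      obtain \<rho>0 where "b' (g q) = \<sigma>' @ \<rho>0"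
        using m0 iq by blast
      then show ?thesis using len[of q] ll iq(2) by (cases \<rho>0) auto
    qed
    obtain q1 where q1: "b q1 = \<sigma> @ [Suc m]" using sb by (metis surjD)
    obtain J where J: "b' (g q1) = \<sigma>' @ [J]" using m[OF _ q1] by auto
    define K where "K = {j. \<exists>q \<rho> \<rho>'. \<rho> \<noteq> [] \<and> b q = \<sigma> @ m # \<rho> \<and> b' (g q) = \<sigma>' @ j # \<rho>'}"
    have "j \<le> J" if "j \<in> K" for j
    proof -
      from that obtain q \<rho> \<rho>' where q: "b q = \<sigma> @ m # \<rho>" "b' (g q) = \<sigma>' @ j # \<rho>'"
        by (auto simp: K_def)
      then have "q < q1" using q1 by (intro less) (simp add: append_strict_mono_lex)
      then show ?thesis using le'[of q q1] q J append_Cons_le_append_Cons by fastforce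
    qed
    then have finK: "finite K" by (meson finite_atMost finite_subset atMost_iff subsetI)
    obtain q0 where q0: "b q0 = \<sigma> @ [m, 0]" using sb by (metis surjD)
    obtain j0 \<rho>0 where "b' (g q0) = \<sigma>' @ j0 # \<rho>0" using m[OF _ q0] by blast
    then have "j0 \<in> K" using q0 unfolding K_def by blast
    then have "K \<noteq> {}" by blast
    define j where "j = Max K"
    have "j \<in> K" unfolding j_def using finK \<open>K \<noteq> {}\<close> by simp
    then obtain q2 \<rho>2 \<rho>2' where q2: "\<rho>2 \<noteq> []" "b q2 = \<sigma> @ m # \<rho>2" "b' (g q2) = \<sigma>' @ j # \<rho>2'"
      by (auto simp: K_def)
    then obtain l \<rho>3 where \<rho>2: "\<rho>2 = l # \<rho>3" by (cases \<rho>2) auto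
    have "\<exists>\<rho>'. b' (g q) = (\<sigma>' @ [j]) @ \<rho>'" if il: "Suc l \<le> i" "b q = (\<sigma> @ [m]) @ i # \<rho>" for q i \<rho>
    proof -
      obtain j' \<rho>' where j': "b' (g q) = \<sigma>' @ j' # \<rho>'" using m[of m q "i # \<rho>"] il by auto
      then have "j' \<in> K" using il by (auto simp: K_def)
      then have "j' \<le> j" using finK by (simp add: j_def)
      moreover have "q2 < q" using il q2 \<rho>2 by (intro less) (simp add: append_strict_mono_lex)
      then have "j \<le> j'" using le'[of q2 q] q2 j' append_Cons_le_append_Cons by fastforce
      ultimately show ?thesis using j' by simp
    qed
    then have "Good (\<sigma> @ [m]) (\<sigma>' @ [j])" using ll unfolding Good_def
      by (intro conjI exI[of _ "Suc l"]) auto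
    moreover have "k \<in> A' (\<sigma>' @ [j])" if k: "k \<in> A (\<sigma> @ [m])" for k
    proof -
      obtain p where "b p = \<sigma> @ [m]" using sb by (metis surjD)
      then obtain r where "p < r" "b r = b p" using c unfolding realizes_def by metis
      then obtain q where q: "p < q" "q < r" "c q = k"
        using realizes_dense[OF c, of p r k] k \<open>b p = _\<close> by auto
      have bq: "b q = \<sigma> @ [m]" using mb q \<open>b p = _\<close> \<open>b r = _\<close>
        by (metis monoD less_imp_le order.antisym)
      then obtain j' where j': "b' (g q) = \<sigma>' @ [j']" using m[OF _ bq] by auto
      have "q < q2" using bq q2 \<rho>2 by (intro less) (simp add: append_strict_mono_lex)
      then have "j' \<le> j" using le'[of q q2] j' q2 append_Cons_le_append_Cons by fastforce
      then have "A' (\<sigma>' @ [j']) \<subseteq> A' (\<sigma>' @ [j])"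
        by (intro monA') (simp add: list_all2_append list_all2_refl)
      then show ?thesis using bA'[of "g q"] g(2)[of q] j' q by auto
    qed
    ultimately show ?thesis by blast
  qed
  define Q where "Q n p \<longleftrightarrow> length (fst p) = n \<and> Good (fst p) (snd p) \<and>
      (n > 0 \<longrightarrow> A (fst p) \<subseteq> A' (snd p))" for n and p :: "nat list \<times> nat list"
  have "\<exists>h. \<forall>n. Q n (h n) \<and> (\<exists>j. snd (h (Suc n)) = snd (h n) @ [j])"
  proof (rule dependent_nat_choice)
    show "\<exists>p. Q 0 p" by (rule exI[of _ "([], [])"]) (auto simp: Q_def Good_def)
    show "\<exists>p'. Q (Suc n) p' \<and> (\<exists>j. snd p' = snd p @ [j])" if "Q n p" for p n
    proof -
      from that have "Good (fst p) (snd p)" by (simp add: Q_def)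
      then obtain i j where ij: "Good (fst p @ [i]) (snd p @ [j])" "A (fst p @ [i]) \<subseteq> A' (snd p @ [j])"
        using step by blast
      then show ?thesis using \<open>Q n p\<close>
        by (intro exI[of _ "(fst p @ [i], snd p @ [j])"]) (auto simp: Q_def)
    qed
  qed
  then obtain h where h: "\<And>n. Q n (h n)" "\<And>n. \<exists>j. snd (h (Suc n)) = snd (h n) @ [j]" by blast
  define \<beta> where "\<beta> n = last (snd (h (Suc n)))" for n
  have lh: "length (snd (h n)) = n" "length (fst (h n)) = n" for n
    using h(1)[of n] by (auto simp: Q_def Good_def)
  have snd_h: "snd (h n) = map \<beta> [0..<n]" for n
  proof (induction n)
    case 0
    then show ?case using lh[of 0] by simp
  next
    case (Suc n)
    then show ?case using h(2)[of n] by (auto simp: \<beta>_def)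
  qed
  have "A (replicate n 0) \<subseteq> A' (map \<beta> [0..<n])" if "n > 0" for n
  proof -
    have "A (replicate n 0) \<subseteq> A (fst (h n))"
      using lh by (intro monA) (simp add: list_all2_conv_all_nth)
    also have "\<dots> \<subseteq> A' (snd (h n))" using h(1)[of n] that by (simp add: Q_def)
    finally show ?thesis by (simp add: snd_h)
  qed
  then show ?thesis by blast
qed

definition rat_den :: "rat \<Rightarrow> nat" where
  "rat_den q = (LEAST d. 0 < d \<and> of_nat d * q \<in> \<int>)"

lemma rat_den: "0 < rat_den q" "of_nat (rat_den q) * q \<in> \<int>"
proof -
  obtain a b where q: "q = Fract a b" "b > 0" by (cases q) auto
  then have "0 < nat b \<and> of_nat (nat b) * q \<in> \<int>"
    by (simp add: Fract_of_int_quotient)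
  then have "0 < rat_den q \<and> of_nat (rat_den q) * q \<in> \<int>"
    unfolding rat_den_def by (rule LeastI)
  then show "0 < rat_den q" "of_nat (rat_den q) * q \<in> \<int>" by auto
qed

lemma rat_den_frac_less:
  fixes q :: rat
  assumes "1 / 2 \<le> frac q"
  shows "rat_den (1 / (1 - frac q) - 2) < rat_den q"
proof -
  define d where "d = rat_den q"
  have "of_nat d * (1 - frac q) = of_nat d * of_int (1 + \<lfloor>q\<rfloor>) - of_nat d * q"
    by (simp add: frac_def algebra_simps)
  also have "\<dots> \<in> \<int>" using rat_den(2)[of q] by (auto simp: d_def)
  finally obtain e where e: "of_nat d * (1 - frac q) = of_int e" by (elim Ints_cases)
  have d: "0 < d" using rat_den(1) by (simp add: d_def)
  have fr: "1 - frac q < 1" using assms by linarith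
  have x: "0 < 1 - frac q" using frac_lt_1[of q] by simp
  then have "0 < (of_int e :: rat)" unfolding e[symmetric] using d by simp
  then have e0: "0 < e" by simp
  have "of_int e < (of_nat d :: rat)" unfolding e[symmetric]
    using mult_strict_left_mono[of "1 - frac q" 1 "of_nat d"] d fr by simp
  then have ed: "nat e < d" using e0 by (metis of_int_less_iff of_int_of_nat_eq zless_nat_eq_int_zless nat_less_iff less_imp_le)
  have "of_nat (nat e) * (1 / (1 - frac q) - 2) = of_nat d - 2 * (of_int e :: rat)"
    using e0 x unfolding e[symmetric] by (simp add: e[symmetric] field_simps)
  also have "\<dots> \<in> \<int>" by auto
  finally have "rat_den (1 / (1 - frac q) - 2) \<le> nat e"
    unfolding rat_den_def[of "1 / (1 - frac q) - 2"] using e0 by (intro Least_le) auto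
  then show ?thesis using ed by (simp add: d_def)
qed

text \<open>
  A continued fraction expansion: the block of \<open>q \<ge> 0\<close> starts with \<open>\<lfloor>q\<rfloor>\<close>, and the upper half of
  \<open>[\<lfloor>q\<rfloor>, \<lfloor>q\<rfloor> + 1)\<close> is blown up to \<open>[0, \<infinity>)\<close>.  Every rational lies in a block since
  the expansion is finite.
\<close>

function cf_block :: "rat \<Rightarrow> nat list" where
  "cf_block q = (if q < 0 then [] else
     nat \<lfloor>q\<rfloor> # (if frac q < 1 / 2 then [] else cf_block (1 / (1 - frac q) - 2)))"
  by pat_completeness auto
termination
  by (relation "Wellfounded.measure rat_den") (auto intro!: rat_den_frac_less)

declare cf_block.simps [simp del]

lemma cf_block_neg: "q < 0 \<Longrightarrow> cf_block q = []"
  by (subst cf_block.simps) simp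

lemma cf_block_mono: "q \<le> r \<Longrightarrow> cf_block q \<le> cf_block r"
proof (induction q arbitrary: r rule: cf_block.induct)
  case (1 q)
  show ?case
  proof (cases "q < 0")
    case True
    then show ?thesis by (subst cf_block.simps) simp
  next
    case False
    have fl: "\<lfloor>q\<rfloor> \<le> \<lfloor>r\<rfloor>" using 1(2) by (rule floor_mono)
    note unf = cf_block.simps[of q] cf_block.simps[of r]
    show ?thesis
    proof (cases "\<lfloor>q\<rfloor> = \<lfloor>r\<rfloor>")
      case True
      then have fr: "frac q \<le> frac r" using 1(2) by (simp add: frac_def)
      show ?thesis
      proof (cases "frac q < 1 / 2")
        case True
        then show ?thesis using False 1(2) \<open>\<lfloor>q\<rfloor> = \<lfloor>r\<rfloor>\<close> by (subst (1 2) cf_block.simps) simp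
      next
        case h: False
        have "1 / (1 - frac q) \<le> 1 / (1 - frac r)"
          using fr frac_lt_1[of r] by (intro divide_left_mono) auto
        then have "cf_block (1 / (1 - frac q) - 2) \<le> cf_block (1 / (1 - frac r) - 2)"
          using False h by (intro 1(1)) auto
        then show ?thesis using False 1(2) \<open>\<lfloor>q\<rfloor> = \<lfloor>r\<rfloor>\<close> h fr
          by (subst (1 2) cf_block.simps) simp
      qed
    next
      case f: False
      then have "nat \<lfloor>q\<rfloor> < nat \<lfloor>r\<rfloor>" using fl False by linarith
      moreover have "\<not> r < 0" using False 1(2) by linarith
      ultimately have "cf_block q < cf_block r"
        unfolding unf using False by (simp only: if_False if_not_P Cons_less_Cons simp_thms)
      then show ?thesis by simp
    qed
  qed
qed

lemma cf_block_lift: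
  fixes y :: rat
  assumes "0 \<le> y"
  shows "cf_block (of_nat i + 1 - 1 / (y + 2)) = i # cf_block y"
proof -
  define x where "x = 1 - 1 / (y + 2)"
  have x: "1 / 2 \<le> x" "x < 1" using assms by (auto simp: x_def field_simps)
  then have "\<lfloor>of_nat i + x\<rfloor> = int i" "frac (of_nat i + x) = x"
    by (auto simp: frac_def floor_eq_iff)
  moreover have "1 / (1 - x) - 2 = y" using assms by (simp add: x_def)
  ultimately have "cf_block (of_nat i + x) = i # cf_block y"
    using x by (subst cf_block.simps) auto
  then show ?thesis by (simp add: x_def algebra_simps)
qed

lemma surj_cf_block: "surj cf_block"
proof -
  have "\<exists>q\<ge>0. cf_block q = i # \<sigma>" for i \<sigma>
  proof (induction \<sigma> arbitrary: i)
    case Nil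
    have "cf_block (of_nat i) = [i]" by (subst cf_block.simps) (simp add: frac_def)
    then show ?case by (intro exI[of _ "of_nat i"]) simp
  next
    case (Cons j \<sigma>)
    then obtain y where y: "0 \<le> y" "cf_block y = j # \<sigma>" by blast
    then have "0 \<le> of_nat i + 1 - 1 / (y + 2)" by (simp add: field_simps)
    then show ?case using y cf_block_lift[of y i] by metis
  qed
  moreover have "cf_block (- 1) = []" by (subst cf_block.simps) simp
  ultimately show ?thesis unfolding surj_def by (metis list.exhaust)
qed

lemma cf_block_right: "\<exists>r>q. cf_block r = cf_block q"
proof (induction q rule: cf_block.induct)
  case (1 q)
  show ?case
  proof (cases "q < 0")
    case True
    then show ?thesis by (intro exI[of _ "q / 2"]) (auto simp: cf_block_neg)
  next
    case False
    define x where "x = frac q"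
    have q: "q = of_nat (nat \<lfloor>q\<rfloor>) + x" using False by (simp add: x_def frac_def)
    have x: "0 \<le> x" "x < 1" by (auto simp: x_def frac_lt_1)
    show ?thesis
    proof (cases "x < 1 / 2")
      case True
      define x' where "x' = (x + 1 / 2) / 2"
      have x': "x < x'" "x' < 1 / 2" using True by (auto simp: x'_def field_simps)
      then have "\<lfloor>of_nat (nat \<lfloor>q\<rfloor>) + x'\<rfloor> = \<lfloor>q\<rfloor>" "frac (of_nat (nat \<lfloor>q\<rfloor>) + x') = x'"
        using False x by (auto simp: frac_def floor_eq_iff)
      moreover have "0 \<le> of_nat (nat \<lfloor>q\<rfloor>) + x'" using x x' by simp
      ultimately have "cf_block (of_nat (nat \<lfloor>q\<rfloor>) + x') = cf_block q"
        using False True x' by (subst (1 2) cf_block.simps) (auto simp: x_def)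
      moreover have "q < of_nat (nat \<lfloor>q\<rfloor>) + x'" using q x'(1) by linarith
      ultimately show ?thesis by blast
    next
      case h: False
      define y where "y = 1 / (1 - x) - 2"
      have y: "0 \<le> y" using h x by (auto simp: y_def field_simps)
      obtain r where r: "y < r" "cf_block r = cf_block y"
        using 1 False h by (auto simp: x_def y_def)
      have xy: "1 - 1 / (y + 2) = x" using x by (simp add: y_def)
      have "1 / (r + 2) < 1 / (y + 2)" using r y by (intro divide_strict_left_mono) auto
      then have "q < of_nat (nat \<lfloor>q\<rfloor>) + 1 - 1 / (r + 2)" using q xy by linarith
      moreover have "cf_block (of_nat (nat \<lfloor>q\<rfloor>) + 1 - 1 / (y + 2)) = cf_block (of_nat (nat \<lfloor>q\<rfloor>) + 1 - 1 / (r + 2))"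
        using cf_block_lift y r by simp
      moreover have "of_nat (nat \<lfloor>q\<rfloor>) + 1 - 1 / (y + 2) = q" using q xy by linarith
      ultimately have "q < of_nat (nat \<lfloor>q\<rfloor>) + 1 - 1 / (r + 2) \<and>
          cf_block (of_nat (nat \<lfloor>q\<rfloor>) + 1 - 1 / (r + 2)) = cf_block q" by simp
      then show ?thesis by blast
    qed
  qed
qed

lemma dense_colouring: "\<exists>d :: rat \<Rightarrow> nat. \<forall>n p r. p < r \<longrightarrow> (\<exists>t. p < t \<and> t < r \<and> d t = n)"
proof -
  define D where "D n = {t :: rat. \<exists>a b. odd a \<and> odd b \<and> t * of_int (2 ^ n * b) = of_int a}" for n
  have disj: "\<not> n < m" if "t \<in> D n" "t \<in> D m" for t n m
  proof
    assume "n < m"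
    from that obtain a b a' b' where ab: "odd a" "odd b" "t * of_int (2 ^ n * b) = of_int a"
      "odd a'" "odd b'" "t * of_int (2 ^ m * b') = of_int a'"
      by (auto simp: D_def)
    have "of_int (a * (2 ^ (m - n) * b')) = t * of_int (2 ^ n * b) * of_int (2 ^ (m - n) * b')"
      using ab by simp
    also have "(2 :: rat) ^ n * 2 ^ (m - n) = 2 ^ m"
      using \<open>n < m\<close> by (simp flip: power_add)
    then have "t * of_int (2 ^ n * b) * of_int (2 ^ (m - n) * b') = t * of_int (2 ^ m * b') * of_int b"
      by simp
    also have "\<dots> = of_int (a' * b)" using ab by simp
    finally have "a * (2 ^ (m - n) * b') = a' * b" by (metis of_int_eq_iff)
    moreover have "even (a * (2 ^ (m - n) * b'))" using \<open>n < m\<close> by simp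
    ultimately show False using ab by auto
  qed
  have dense: "\<exists>t. p < t \<and> t < r \<and> t \<in> D n" if "p < r" for p r n
  proof -
    obtain k :: nat where k: "3 / (r - p) < of_nat k" using reals_Archimedean2 by blast
    define b where "b = 2 * int k + 1"
    define N where "N = (2 ^ n * of_int b :: rat)"
    have "of_nat k < (of_int b :: rat)" by (simp add: b_def)
    also have "\<dots> \<le> N" by (simp add: N_def b_def)
    finally have "3 / (r - p) < N" using k by simp
    then have N3: "3 < (r - p) * N" using that by (simp add: field_simps)
    have N0: "0 < N" unfolding N_def b_def by (intro mult_pos_pos) auto
    define a where "a = 2 * \<lfloor>p * N / 2\<rfloor> + 3"
    have "of_int \<lfloor>p * N / 2\<rfloor> \<le> p * N / 2" "p * N / 2 < of_int \<lfloor>p * N / 2\<rfloor> + 1" by linarith+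
    then have "p * N < of_int a" "of_int a < r * N" using N3 by (auto simp: a_def algebra_simps)
    then have "p < of_int a / N" "of_int a / N < r" using N0 by (auto simp: field_simps)
    moreover have "of_int a / N * of_int (2 ^ n * b) = of_int a" "odd a" "odd b"
      using N0 by (auto simp: N_def a_def b_def)
    then have "of_int a / N \<in> D n" unfolding D_def by blast
    ultimately show ?thesis by blast
  qed
  have "(THE n. t \<in> D n) = n" if "t \<in> D n" for t n
    using that disj by (intro the_equality) (auto intro: linorder_neqE_nat)
  then have "\<exists>t. p < t \<and> t < r \<and> (THE n. t \<in> D n) = n" if "p < r" for n p r
    using dense[OF that, of n] by blast
  then show ?thesis by (intro exI[of _ "\<lambda>t. THE n. t \<in> D n"]) simp
qed

definition dense_colour :: "rat \<Rightarrow> nat" where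
  "dense_colour = (SOME d. \<forall>n p r. p < r \<longrightarrow> (\<exists>t. p < t \<and> t < r \<and> d t = n))"

lemma dense_colour: "p < r \<Longrightarrow> \<exists>t. p < t \<and> t < r \<and> dense_colour t = n"
  using someI_ex[OF dense_colouring] by (auto simp: dense_colour_def)

definition colouring :: "(nat list \<Rightarrow> nat set) \<Rightarrow> (nat list \<Rightarrow> nat) \<Rightarrow> rat \<Rightarrow> nat" where
  "colouring A a q = (if dense_colour q \<in> A (cf_block q) then dense_colour q else a (cf_block q))"

lemma realizes_colouring:
  assumes "\<And>\<sigma>. a \<sigma> \<in> A \<sigma>"
  shows "realizes (colouring A a) A cf_block"
  unfolding realizes_def
proof (intro conjI allI impI ballI)
  show "mono cf_block" by (intro monoI cf_block_mono)
  show "colouring A a q \<in> A (cf_block q)" for q using assms by (simp add: colouring_def)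
  fix p r k assume pr: "p < r" "cf_block p = cf_block r" "k \<in> A (cf_block p)"
  obtain t where t: "p < t" "t < r" "dense_colour t = k" using dense_colour[OF pr(1)] by blast
  have "cf_block p \<le> cf_block t" "cf_block t \<le> cf_block r" using t by (auto intro!: cf_block_mono)
  then have "cf_block t = cf_block p" using pr by simp
  then show "\<exists>t>p. t < r \<and> colouring A a t = k"
    using t pr by (intro exI[of _ t]) (auto simp: colouring_def)
qed (use surj_cf_block cf_block_right in auto)

section \<open>Approximating an analytic quasi-order\<close>

lemma compact_fun_box:
  fixes S :: "'i \<Rightarrow> 'a::topological_space set"
  assumes "\<And>i. compact (S i)"
  shows "compact {f. \<forall>i. f i \<in> S i}"
proof -
  have "compactin (product_topology (\<lambda>i. euclidean) UNIV) (PiE UNIV S)"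
    using assms by (simp add: compactin_PiE compactin_euclidean_iff)
  moreover have "PiE UNIV S = {f. \<forall>i. f i \<in> S i}" by (auto simp: PiE_UNIV_domain)
  ultimately show ?thesis by (simp add: euclidean_product_topology compactin_euclidean_iff)
qed

lemma tendsto_fun_iff:
  fixes f :: "'a \<Rightarrow> 'i \<Rightarrow> 'b::topological_space"
  shows "(f \<longlongrightarrow> l) F \<longleftrightarrow> (\<forall>i. ((\<lambda>x. f x i) \<longlongrightarrow> l i) F)"
  using limitin_componentwise[of "\<lambda>_. euclidean :: 'b topology" UNIV f l F]
  by (simp add: euclidean_product_topology limitin_canonical_iff)

definition agree :: "nat \<Rightarrow> (nat \<Rightarrow> 'a) \<Rightarrow> (nat \<Rightarrow> 'a) \<Rightarrow> bool" where
  "agree n x y \<longleftrightarrow> (\<forall>i<n. x i = y i)"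

lemma agree_refl [simp]: "agree n x x"
  and agree_sym: "agree n x y \<Longrightarrow> agree n y x"
  and agree_trans: "agree n x y \<Longrightarrow> agree n y z \<Longrightarrow> agree n x z"
  by (auto simp: agree_def)

definition linked :: "((nat \<Rightarrow> nat) \<times> (nat \<Rightarrow> nat) \<times> (nat \<Rightarrow> nat)) set \<Rightarrow> nat \<Rightarrow>
    (nat \<Rightarrow> nat) \<Rightarrow> (nat \<Rightarrow> nat) \<Rightarrow> (nat \<Rightarrow> nat) \<Rightarrow> bool" where
  "linked C n x y \<beta> \<longleftrightarrow>
     (\<exists>w. agree n (w 0) x \<and> agree n (w (\<beta> 0)) y \<and>
        (\<forall>j<\<beta> 0. \<exists>a b \<alpha>. (a, b, \<alpha>) \<in> C \<and> agree n a (w j) \<and> agree n b (w (Suc j)) \<and>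
           (\<forall>i<n. \<alpha> i \<le> \<beta> i)))"

lemma linked_trans:
  assumes "linked C n x y \<beta>" "linked C n y z \<gamma>"
  shows "linked C n x z (\<lambda>i. \<beta> i + \<gamma> i)"
proof -
  from assms(1) obtain w where w: "agree n (w 0) x" "agree n (w (\<beta> 0)) y"
    "\<And>j. j < \<beta> 0 \<Longrightarrow> \<exists>a b \<alpha>. (a, b, \<alpha>) \<in> C \<and> agree n a (w j) \<and> agree n b (w (Suc j)) \<and> (\<forall>i<n. \<alpha> i \<le> \<beta> i)"
    by (auto simp: linked_def)
  from assms(2) obtain v where v: "agree n (v 0) y" "agree n (v (\<gamma> 0)) z"
    "\<And>j. j < \<gamma> 0 \<Longrightarrow> \<exists>a b \<alpha>. (a, b, \<alpha>) \<in> C \<and> agree n a (v j) \<and> agree n b (v (Suc j)) \<and> (\<forall>i<n. \<alpha> i \<le> \<gamma> i)"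
    by (auto simp: linked_def)
  define u where "u j = (if j < \<beta> 0 then w j else v (j - \<beta> 0))" for j
  have uw: "agree n (w j) (u j)" if "j \<le> \<beta> 0" for j
    using that w(2) v(1) by (cases "j = \<beta> 0") (auto simp: u_def intro: agree_trans agree_sym)
  have uv: "u (\<beta> 0 + j) = v j" for j by (simp add: u_def)
  have "\<exists>a b \<alpha>. (a, b, \<alpha>) \<in> C \<and> agree n a (u j) \<and> agree n b (u (Suc j)) \<and> (\<forall>i<n. \<alpha> i \<le> \<beta> i + \<gamma> i)"
    if "j < \<beta> 0 + \<gamma> 0" for j
  proof (cases "j < \<beta> 0")
    case True
    with w(3) obtain a b \<alpha> where "(a, b, \<alpha>) \<in> C" "agree n a (w j)" "agree n b (w (Suc j))" "\<forall>i<n. \<alpha> i \<le> \<beta> i"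
      by blast
    then show ?thesis using True uw[of j] uw[of "Suc j"]
      by (intro exI[of _ a] exI[of _ b] exI[of _ \<alpha>]) (auto intro: agree_trans trans_le_add1)
  next
    case False
    then obtain k where k: "j = \<beta> 0 + k" by (metis le_Suc_ex not_less)
    then have "k < \<gamma> 0" using that by simp
    with v(3) obtain a b \<alpha> where "(a, b, \<alpha>) \<in> C" "agree n a (v k)" "agree n b (v (Suc k))" "\<forall>i<n. \<alpha> i \<le> \<gamma> i"
      by blast
    then show ?thesis using uv[of k] uv[of "Suc k"] k
      by (intro exI[of _ a] exI[of _ b] exI[of _ \<alpha>]) (auto intro: trans_le_add2)
  qed
  moreover have "agree n (u 0) x" using uw[of 0] w(1) by (meson agree_sym agree_trans le0)
  moreover have "agree n (u (\<beta> 0 + \<gamma> 0)) z" using uv[of "\<gamma> 0"] v(2) by simp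
  ultimately show ?thesis unfolding linked_def by blast
qed

lemma linked_zero: "\<beta> 0 = 0 \<Longrightarrow> linked C n x y \<beta> \<Longrightarrow> agree n x y"
  by (auto simp: linked_def agree_def)

lemma linked_cong:
  assumes "0 < n" "agree n x x'" "agree n y y'" "agree n \<beta> \<beta>'"
  shows "linked C n x y \<beta> \<longleftrightarrow> linked C n x' y' \<beta>'"
proof -
  have "agree n u x \<longleftrightarrow> agree n u x'" "agree n u y \<longleftrightarrow> agree n u y'" for u
    using assms by (auto simp: agree_def)
  moreover have "\<beta> 0 = \<beta>' 0" "(\<forall>i<n. \<alpha> i \<le> \<beta> i) \<longleftrightarrow> (\<forall>i<n. \<alpha> i \<le> \<beta>' i)" for \<alpha>
    using assms by (auto simp: agree_def)
  ultimately show ?thesis unfolding linked_def by simp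
qed

locale closed_code =
  fixes C :: "((nat \<Rightarrow> nat) \<times> (nat \<Rightarrow> nat) \<times> (nat \<Rightarrow> nat)) set"
  assumes closed: "closed C"
    and bounded: "(x, y, \<alpha>) \<in> C \<Longrightarrow> x i \<le> 1 \<and> y i \<le> 1"
    and diag: "(\<And>i. x i \<le> 1) \<Longrightarrow> (x, x, \<alpha>) \<in> C"
    and trans: "(x, y, \<alpha>) \<in> C \<Longrightarrow> (y, z, \<beta>) \<in> C \<Longrightarrow> \<exists>\<gamma>. (x, z, \<gamma>) \<in> C"
begin

lemma linked_refl:
  assumes "\<And>i. x i \<le> 1"
  shows "linked C n x x \<beta>"
proof -
  have "(x, x, \<lambda>_. 0) \<in> C" using assms by (rule diag)
  then have "\<exists>a b \<alpha>. (a, b, \<alpha>) \<in> C \<and> agree n a x \<and> agree n b x \<and> (\<forall>i<n. \<alpha> i \<le> \<beta> i)"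
    by (intro exI[of _ x] exI[of _ "\<lambda>_. 0"]) simp
  then show ?thesis unfolding linked_def by (intro exI[of _ "\<lambda>_. x"]) simp
qed

lemma linked_of_code:
  assumes "(x, y, \<alpha>) \<in> C"
  shows "\<exists>\<beta>. \<forall>n. linked C n x y \<beta>"
proof -
  define \<beta> where "\<beta> i = Suc (\<alpha> i)" for i
  have y: "(y, y, \<lambda>_. 0) \<in> C" using bounded[OF assms] by (intro diag) auto
  have "\<exists>a b \<delta>. (a, b, \<delta>) \<in> C \<and> agree n a (if j = 0 then x else y) \<and>
      agree n b (if Suc j = 0 then x else y) \<and> (\<forall>i<n. \<delta> i \<le> \<beta> i)" for n j
  proof (cases "j = 0")
    case True
    then show ?thesis using assms
      by (intro exI[of _ x] exI[of _ y] exI[of _ \<alpha>]) (auto simp: \<beta>_def)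
  next
    case False
    then show ?thesis using y
      by (intro exI[of _ y] exI[of _ "\<lambda>_. 0"]) auto
  qed
  then have "linked C n x y \<beta>" for n
    unfolding linked_def by (intro exI[of _ "\<lambda>j. if j = 0 then x else y"]) (auto simp: \<beta>_def)
  then show ?thesis by blast
qed

lemma code_of_linked:
  assumes x: "\<And>i. x i \<le> 1" and L: "\<And>n. linked C n x y \<beta>"
  shows "\<exists>\<alpha>. (x, y, \<alpha>) \<in> C"
proof (cases "\<beta> 0 = 0")
  case True
  have "x i = y i" for i using linked_zero[OF True L[of "Suc i"]] by (simp add: agree_def)
  then have "x = y" by auto
  then show ?thesis using diag[of x "\<lambda>_. 0"] x by auto
next
  case m: False
  define m where "m = \<beta> 0"
  have "\<exists>w. agree n (w 0) x \<and> agree n (w m) y \<and>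
     (\<forall>j<m. \<exists>a b \<alpha>. (a, b, \<alpha>) \<in> C \<and> agree n a (w j) \<and> agree n b (w (Suc j)) \<and> (\<forall>i<n. \<alpha> i \<le> \<beta> i))" for n
    using L[of n] by (simp add: linked_def m_def)
  then obtain w where w: "\<And>n. agree n (w n 0) x" "\<And>n. agree n (w n m) y" and
    "\<And>n j. j < m \<Longrightarrow> \<exists>a b \<alpha>. (a, b, \<alpha>) \<in> C \<and> agree n a (w n j) \<and> agree n b (w n (Suc j)) \<and> (\<forall>i<n. \<alpha> i \<le> \<beta> i)"
    by metis
  then have "\<forall>n j. \<exists>t. j < m \<longrightarrow> t \<in> C \<and> agree n (fst t) (w n j) \<and> agree n (fst (snd t)) (w n (Suc j)) \<and>
      (\<forall>i<n. snd (snd t) i \<le> \<beta> i)"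
    by (metis fst_conv snd_conv)
  then obtain t where t: "\<And>n j. j < m \<Longrightarrow> t n j \<in> C \<and> agree n (fst (t n j)) (w n j) \<and>
      agree n (fst (snd (t n j))) (w n (Suc j)) \<and> (\<forall>i<n. snd (snd (t n j)) i \<le> \<beta> i)"
    by metis
  define a b \<alpha> where "a n j = fst (t n j)" and "b n j = fst (snd (t n j))" and "\<alpha> n j = snd (snd (t n j))" for n j
  have ab: "\<And>n j. j < m \<Longrightarrow> (a n j, b n j, \<alpha> n j) \<in> C"
    "\<And>n j. j < m \<Longrightarrow> agree n (a n j) (w n j)" "\<And>n j. j < m \<Longrightarrow> agree n (b n j) (w n (Suc j))"
    "\<And>n j i. j < m \<Longrightarrow> i < n \<Longrightarrow> \<alpha> n j i \<le> \<beta> i"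
    using t by (auto simp: a_def b_def \<alpha>_def)
  define K :: "((nat \<Rightarrow> nat) \<times> (nat \<Rightarrow> nat) \<times> (nat \<Rightarrow> nat)) set"
    where "K = {f. \<forall>i. f i \<in> {..1}} \<times> {f. \<forall>i. f i \<in> {..1}} \<times> {f. \<forall>i. f i \<in> {..\<beta> i}}"
  have "compact K" unfolding K_def by (intro compact_Times compact_fun_box finite_imp_compact) auto
  define G where "G n j = (if j < m then (a n j, b n j, \<lambda>i. min (\<alpha> n j i) (\<beta> i)) else (\<lambda>_. 0, \<lambda>_. 0, \<lambda>_. 0))" for n j
  have "compact {f. \<forall>j::nat. f j \<in> K}" using \<open>compact K\<close> by (rule compact_fun_box)
  then have "seq_compact {f. \<forall>j::nat. f j \<in> K}" by (rule compact_imp_seq_compact)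
  moreover have "\<forall>n. G n \<in> {f. \<forall>j. f j \<in> K}"
    using bounded[OF ab(1)] by (auto simp: G_def K_def)
  ultimately obtain l r where "l \<in> {f. \<forall>j. f j \<in> K}" and r: "strict_mono r" and l: "(G \<circ> r) \<longlonglongrightarrow> l"
    by (rule seq_compactE)
  have lj: "(\<lambda>k. G (r k) j) \<longlonglongrightarrow> l j" for j using l by (simp add: tendsto_fun_iff)
  define A B where "A j = fst (l j)" and "B j = fst (snd (l j))" for j
  have la: "(\<lambda>k. a (r k) j) \<longlonglongrightarrow> A j" and lb: "(\<lambda>k. b (r k) j) \<longlonglongrightarrow> B j"
    and lmin: "(\<lambda>k i. min (\<alpha> (r k) j i) (\<beta> i)) \<longlonglongrightarrow> snd (snd (l j))" if "j < m" for j
    using tendsto_fst[OF lj[of j]] tendsto_fst[OF tendsto_snd[OF lj[of j]]]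
      tendsto_snd[OF tendsto_snd[OF lj[of j]]] that
    by (auto simp: G_def A_def B_def)
  have large: "\<forall>\<^sub>F k in sequentially. i < r k" for i
    using r by (meson eventually_sequentiallyI less_le_trans seq_suble lessI Suc_le_eq order_refl)
  have al: "(\<lambda>k. \<alpha> (r k) j) \<longlonglongrightarrow> snd (snd (l j))" if "j < m" for j
    unfolding tendsto_fun_iff
  proof
    fix i
    have "\<forall>\<^sub>F k in sequentially. \<alpha> (r k) j i = min (\<alpha> (r k) j i) (\<beta> i)"
      using large[of i] by (rule eventually_mono) (simp add: ab(4) that)
    moreover have "(\<lambda>k. min (\<alpha> (r k) j i) (\<beta> i)) \<longlonglongrightarrow> snd (snd (l j)) i"
      using lmin[OF that] unfolding tendsto_fun_iff by blast
    ultimately show "(\<lambda>k. \<alpha> (r k) j i) \<longlonglongrightarrow> snd (snd (l j)) i"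
      by (subst tendsto_cong)
  qed
  have inC: "(A j, B j, snd (snd (l j))) \<in> C" if "j < m" for j
    using closed_sequentially[OF closed, of "\<lambda>k. (a (r k) j, b (r k) j, \<alpha> (r k) j)"]
      tendsto_Pair[OF la[OF that] tendsto_Pair[OF lb[OF that] al[OF that]]] ab(1)[OF that]
    by auto
  have lim_eq: "f = g" if "h \<longlonglongrightarrow> f" "h' \<longlonglongrightarrow> g" "\<And>k. agree (r k) (h k) (h' k)"
    for h h' :: "nat \<Rightarrow> nat \<Rightarrow> nat" and f g
  proof
    fix i
    have "\<forall>\<^sub>F k in sequentially. h k i = f i" "\<forall>\<^sub>F k in sequentially. h' k i = g i"
      using that(1,2) by (auto simp: tendsto_fun_iff tendsto_discrete)
    with large[of i] have "\<forall>\<^sub>F k in sequentially. f i = g i"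
    proof eventually_elim
      case (elim k)
      then show ?case using that(3)[of k] by (simp add: agree_def)
    qed
    then show "f i = g i" by simp
  qed
  have A0: "A 0 = x" using m ab(2) w(1)
    by (intro lim_eq[OF la tendsto_const]) (auto simp: m_def intro: agree_trans)
  have "\<exists>\<gamma>. (x, B j, \<gamma>) \<in> C" if "j < m" for j
    using that
  proof (induction j)
    case 0
    then show ?case using inC[of 0] A0 by auto
  next
    case (Suc j)
    then have "agree n (b n j) (a n (Suc j))" for n
      by (meson Suc_lessD ab(2,3) agree_sym agree_trans)
    then have "B j = A (Suc j)" using Suc.prems by (intro lim_eq[OF lb la]) auto
    then show ?case using Suc inC[of "Suc j"] trans by (metis Suc_lessD)
  qed
  moreover have "B (m - 1) = y" using m ab(3)[of "m - 1"] w(2)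
    by (intro lim_eq[OF lb tendsto_const]) (auto simp: m_def intro: agree_trans)
  ultimately show ?thesis using m by (metis diff_less m_def neq0_conv zero_less_one)
qed

end

lemma euclidean_eq_discrete: "(euclidean :: 'a::discrete_topology topology) = discrete_topology UNIV"
  by (simp add: topology_eq open_discrete)

lemma completely_metrizable_fun_nat:
  "completely_metrizable_space (euclidean :: ('i::countable \<Rightarrow> nat) topology)"
proof -
  have "completely_metrizable_space (euclidean :: nat topology)"
    unfolding euclidean_eq_discrete by (rule completely_metrizable_space_discrete_topology)
  then have "completely_metrizable_space (product_topology (\<lambda>i::'i. euclidean :: nat topology) UNIV)"
    unfolding completely_metrizable_space_product_topology
    by (intro disjI2 conjI ballI countableI_type)
  then show ?thesis unfolding euclidean_product_topology .
qed

lemma second_countable_euclidean: "second_countable (euclidean :: 'a::second_countable_topology topology)"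
proof -
  obtain B :: "'a set set" where B: "countable B" "topological_basis B"
    using ex_countable_basis by blast
  have "\<exists>V\<in>B. x \<in> V \<and> V \<subseteq> U" if U: "open U" "x \<in> U" for U x
    by (rule topological_basisE[OF B(2) U]) blast
  moreover have "open V" if "V \<in> B" for V using topological_basis_open[OF B(2) that] .
  ultimately show ?thesis unfolding second_countable_def using B(1) by (intro exI[of _ B]) simp
qed

lemma standard_borel_fun_nat: "standard_borel (borel :: ('i::countable \<Rightarrow> nat) measure)"
  unfolding standard_borel_def
proof (intro exI[of _ euclidean] conjI)
  show "sets borel = sigma_sets (space borel) {U. openin (euclidean :: ('i \<Rightarrow> nat) topology) U}"
    by (simp add: sets_borel)
qed (simp_all add: completely_metrizable_fun_nat second_countable_euclidean)

definition proj_closed :: "'a::topological_space set \<Rightarrow> bool" where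
  "proj_closed D \<longleftrightarrow> (\<exists>F :: ('a \<times> (nat \<Rightarrow> nat)) set. closed F \<and> D = {z. \<exists>\<gamma>. (z, \<gamma>) \<in> F})"

lemma proj_closed_closed: "closed D \<Longrightarrow> proj_closed D"
  unfolding proj_closed_def by (intro exI[of _ "D \<times> UNIV"]) (auto intro: closed_Times)

lemma closed_vimage_fst_map:
  fixes F :: "('a::topological_space \<times> (nat \<Rightarrow> nat)) set"
  assumes "closed F"
  shows "closed ((\<lambda>p. (fst p, \<lambda>n. snd p (f n))) -` F)"
  using assms
  by (rule closed_vimage)
     (intro continuous_intros continuous_on_product_then_coordinatewise[OF continuous_on_snd])

lemma proj_closed_UN:
  assumes "\<And>i::nat. proj_closed (A i)"
  shows "proj_closed (\<Union>i. A i)"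
proof -
  from assms have "\<forall>i. \<exists>F :: ('a \<times> (nat \<Rightarrow> nat)) set. closed F \<and> A i = {z. \<exists>\<gamma>. (z, \<gamma>) \<in> F}"
    unfolding proj_closed_def by blast
  from choice[OF this] obtain F where "\<forall>i. closed (F i) \<and> A i = {z. \<exists>\<gamma>::nat \<Rightarrow> nat. (z, \<gamma>) \<in> F i}" ..
  then have F: "\<And>i. closed (F i)" "\<And>i. A i = {z. \<exists>\<gamma>. (z, \<gamma>) \<in> F i}" by blast+
  define G where "G = (\<Inter>i. (\<lambda>p. snd p 0) -` (- {i}) \<union> (\<lambda>p. (fst p, \<lambda>n. snd p (Suc n))) -` F i)"
  have "closed ((\<lambda>p :: 'a \<times> (nat \<Rightarrow> nat). snd p 0) -` (- {i}))" for i
    by (rule closed_vimage)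
       (auto intro!: continuous_intros continuous_on_product_then_coordinatewise[OF continuous_on_snd]
             simp: closed_def open_discrete)
  then have "closed G" unfolding G_def using F(1)
    by (intro closed_INT ballI closed_Un closed_vimage_fst_map) auto
  moreover have "z \<in> (\<Union>i. A i) \<longleftrightarrow> (\<exists>\<gamma>. (z, \<gamma>) \<in> G)" for z
  proof
    assume "z \<in> (\<Union>i. A i)"
    then obtain i \<gamma> where "(z, \<gamma>) \<in> F i" using F(2) by auto
    then have "(z, case_nat i \<gamma>) \<in> G" by (auto simp: G_def)
    then show "\<exists>\<gamma>. (z, \<gamma>) \<in> G" by blast
  next
    assume "\<exists>\<gamma>. (z, \<gamma>) \<in> G"
    then obtain \<gamma> where "(z, \<gamma>) \<in> G" ..
    then have "(z, \<lambda>n. \<gamma> (Suc n)) \<in> F (\<gamma> 0)" by (auto simp: G_def)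
    then show "z \<in> (\<Union>i. A i)" using F(2) by auto
  qed
  ultimately show ?thesis unfolding proj_closed_def by blast
qed

lemma proj_closed_INT:
  assumes "\<And>i::nat. proj_closed (A i)"
  shows "proj_closed (\<Inter>i. A i)"
proof -
  from assms have "\<forall>i. \<exists>F :: ('a \<times> (nat \<Rightarrow> nat)) set. closed F \<and> A i = {z. \<exists>\<gamma>. (z, \<gamma>) \<in> F}"
    unfolding proj_closed_def by blast
  from choice[OF this] obtain F where "\<forall>i. closed (F i) \<and> A i = {z. \<exists>\<gamma>::nat \<Rightarrow> nat. (z, \<gamma>) \<in> F i}" ..
  then have F: "\<And>i. closed (F i)" "\<And>i. A i = {z. \<exists>\<gamma>. (z, \<gamma>) \<in> F i}" by blast+
  define G where "G = (\<Inter>i. (\<lambda>p. (fst p, \<lambda>n. snd p (prod_encode (i, n)))) -` F i)"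
  have "closed G" unfolding G_def using F(1) by (intro closed_INT ballI closed_vimage_fst_map)
  moreover have "z \<in> (\<Inter>i. A i) \<longleftrightarrow> (\<exists>\<gamma>. (z, \<gamma>) \<in> G)" for z
  proof
    assume "z \<in> (\<Inter>i. A i)"
    then have "\<forall>i. \<exists>\<gamma>. (z, \<gamma>) \<in> F i" using F(2) by auto
    then obtain g where "\<And>i. (z, g i) \<in> F i" by metis
    then have "(z, \<lambda>n. case prod_decode n of (i, k) \<Rightarrow> g i k) \<in> G" by (auto simp: G_def)
    then show "\<exists>\<gamma>. (z, \<gamma>) \<in> G" by blast
  next
    assume "\<exists>\<gamma>. (z, \<gamma>) \<in> G"
    then show "z \<in> (\<Inter>i. A i)" using F(2) by (auto simp: G_def)
  qed
  ultimately show ?thesis unfolding proj_closed_def by blast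
qed

lemma proj_closed_borel:
  fixes D :: "'a::topological_space set"
  assumes metr: "metrizable_space (euclidean :: 'a topology)" and D: "D \<in> sets borel"
  shows "proj_closed D"
proof -
  have op: "proj_closed U" if U: "open U" for U :: "'a set"
  proof -
    have "openin euclidean U" using U by simp
    with metr have "fsigma_in euclidean U" by (rule open_imp_fsigma_in)
    then obtain C where C: "(\<forall>n. closedin euclidean (C n)) \<and> (\<forall>n. C n \<subseteq> C (Suc n)) \<and> \<Union> (range C) = U"
      unfolding fsigma_in_ascending by (rule exE)
    then have "proj_closed (\<Union>n. C n)" by (intro proj_closed_UN proj_closed_closed) simp
    then show ?thesis using C by simp
  qed
  from D have "D \<in> sigma_sets UNIV {U. open U}" by (simp add: sets_borel)
  then have "proj_closed D \<and> proj_closed (- D)"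
  proof (induction rule: sigma_sets.induct)
    case (Basic U)
    then show ?case using op[of U] proj_closed_closed[of "- U"] by (simp add: closed_Compl)
  next
    case Empty
    show ?case using proj_closed_closed[of "{}"] proj_closed_closed[of UNIV] by simp
  next
    case (Compl a)
    then show ?case by (simp flip: Compl_eq_Diff_UNIV)
  next
    case (Union a)
    then have "proj_closed (\<Union>i. a i)" "proj_closed (\<Inter>i. - a i)"
      by (intro proj_closed_UN proj_closed_INT; simp)+
    then show ?case by simp
  qed
  then show ?thesis ..
qed

definition pulls_back :: "'a measure \<Rightarrow> ('a \<Rightarrow> 'b) \<Rightarrow> 'b measure \<Rightarrow> bool" where
  "pulls_back M f K \<longleftrightarrow> (\<forall>A\<in>sets M. \<exists>D\<in>sets K. \<forall>x\<in>space M. x \<in> A \<longleftrightarrow> f x \<in> D)"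

lemma pulls_back_sigma:
  assumes sets: "sets M = sigma_sets (space M) G" and K: "space K = UNIV"
    and G: "\<And>A. A \<in> G \<Longrightarrow> \<exists>D\<in>sets K. \<forall>x\<in>space M. x \<in> A \<longleftrightarrow> f x \<in> D"
  shows "pulls_back M f K"
  unfolding pulls_back_def
proof
  fix A assume "A \<in> sets M"
  then have "A \<in> sigma_sets (space M) G" by (simp add: sets)
  then show "\<exists>D\<in>sets K. \<forall>x\<in>space M. x \<in> A \<longleftrightarrow> f x \<in> D"
  proof (induction rule: sigma_sets.induct)
    case (Compl a)
    then obtain D where "D \<in> sets K" "\<forall>x\<in>space M. x \<in> a \<longleftrightarrow> f x \<in> D" by blast
    then show ?case using K sets.compl_sets[of D K] by (intro bexI[of _ "space K - D"]) auto
  next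
    case (Union a)
    then have "\<forall>i. \<exists>D. D \<in> sets K \<and> (\<forall>x\<in>space M. x \<in> a i \<longleftrightarrow> f x \<in> D)" by blast
    from choice[OF this] obtain D where D: "\<forall>i::nat. D i \<in> sets K \<and> (\<forall>x\<in>space M. x \<in> a i \<longleftrightarrow> f x \<in> D i)" ..
    show ?case
    proof (rule bexI[of _ "\<Union>i. D i"])
      show "(\<Union>i. D i) \<in> sets K" using D by auto
      show "\<forall>x\<in>space M. x \<in> (\<Union>i. a i) \<longleftrightarrow> f x \<in> (\<Union>i. D i)" using D by simp
    qed
  qed (use G in auto)
qed

lemma pulls_back_pair:
  assumes "pulls_back M f K" "pulls_back N g L" "space K = UNIV" "space L = UNIV"
  shows "pulls_back (M \<Otimes>\<^sub>M N) (map_prod f g) (K \<Otimes>\<^sub>M L)"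
proof (rule pulls_back_sigma)
  show "sets (M \<Otimes>\<^sub>M N) = sigma_sets (space (M \<Otimes>\<^sub>M N)) {a \<times> b |a b. a \<in> sets M \<and> b \<in> sets N}"
    by (simp add: sets_pair_measure space_pair_measure)
  show "space (K \<Otimes>\<^sub>M L) = UNIV" using assms by (simp add: space_pair_measure)
  fix A assume "A \<in> {a \<times> b |a b. a \<in> sets M \<and> b \<in> sets N}"
  then obtain a b where ab: "A = a \<times> b" "a \<in> sets M" "b \<in> sets N" by blast
  obtain D where D: "D \<in> sets K" "\<forall>x\<in>space M. x \<in> a \<longleftrightarrow> f x \<in> D"
    using assms(1) ab(2) unfolding pulls_back_def by blast
  obtain E where E: "E \<in> sets L" "\<forall>x\<in>space N. x \<in> b \<longleftrightarrow> g x \<in> E"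
    using assms(2) ab(3) unfolding pulls_back_def by blast
  show "\<exists>D\<in>sets (K \<Otimes>\<^sub>M L). \<forall>x\<in>space (M \<Otimes>\<^sub>M N). x \<in> A \<longleftrightarrow> map_prod f g x \<in> D"
    using ab D E by (intro bexI[of _ "D \<times> E"]) (auto simp: space_pair_measure)
qed

lemma pulls_back_id: "pulls_back K (\<lambda>x. x) K"
  unfolding pulls_back_def by blast

lemma standard_borel_code:
  fixes N :: "'a measure"
  assumes "standard_borel N"
  shows "\<exists>e \<in> borel_measurable N. (\<forall>x i. e x i \<le> (1::nat)) \<and> inj_on e (space N) \<and>
    e ` space N \<in> sets (borel :: (nat \<Rightarrow> nat) measure) \<and> pulls_back N e borel"
proof -
  from assms obtain T where "completely_metrizable_space T" and sc0: "second_countable T"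
    and sp0: "topspace T = space N" and sets0: "sets N = sigma_sets (space N) {U. openin T U}"
    unfolding standard_borel_def by blast
  then obtain M d where "Metric_space M d" and comp: "Metric_space.mcomplete M d"
    and T: "T = Metric_space.mtopology M d"
    unfolding completely_metrizable_space_def by blast
  then interpret Metric_space M d by simp
  have sc: "second_countable mtopology" and M: "space N = M"
    and sets: "sets N = sigma_sets (space N) {U. openin mtopology U}"
    using sc0 sp0 sets0 unfolding T by simp_all
  from sc obtain B where "countable B \<and> (\<forall>V\<in>B. openin mtopology V) \<and>
      (\<forall>W x. openin mtopology W \<and> x \<in> W \<longrightarrow> (\<exists>V\<in>B. x \<in> V \<and> V \<subseteq> W))"
    unfolding second_countable_def by (rule exE)
  then have B: "countable B" "\<And>V. V \<in> B \<Longrightarrow> openin mtopology V"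
    "\<And>W x. openin mtopology W \<Longrightarrow> x \<in> W \<Longrightarrow> \<exists>V\<in>B. x \<in> V \<and> V \<subseteq> W"
    by simp_all
  define U where "U = from_nat_into (insert {} B)"
  have U: "range U = insert {} B" unfolding U_def using B(1) by (intro range_from_nat_into) auto
  have Uo: "openin mtopology (U n)" for n
  proof -
    have "U n \<in> insert {} B" using U by blast
    then show ?thesis using B(2) by auto
  qed
  have UN: "U n \<in> sets N" "U n \<subseteq> M" for n
  proof -
    show "U n \<in> sets N" unfolding sets using Uo by (intro sigma_sets.Basic) simp
    show "U n \<subseteq> M" using openin_subset[OF Uo[of n]] by simp
  qed
  have base: "\<exists>n. x \<in> U n \<and> U n \<subseteq> W" if Wx: "openin mtopology W" "x \<in> W" for W x
  proof -
    obtain V where V: "V \<in> B" "x \<in> V" "V \<subseteq> W" using B(3)[OF Wx] by blast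
    then have "V \<in> range U" using U by blast
    then show ?thesis using V by blast
  qed
  define e :: "'a \<Rightarrow> nat \<Rightarrow> nat" where "e x n = (if x \<in> U n then 1 else 0)" for x n
  have em: "e \<in> borel_measurable N"
  proof (rule measurable_coordinatewise_then_product)
    fix n
    have [measurable]: "U n \<in> sets N" by (rule UN(1))
    show "(\<lambda>x. e x n) \<in> borel_measurable N" unfolding e_def by measurable
  qed
  have balls: "\<exists>n. x \<in> U n \<and> U n \<subseteq> mball x r" if "x \<in> M" "r > 0" for x r
    using base[of "mball x r" x] that by auto
  have inj: "inj_on e (space N)"
  proof (rule inj_onI, rule ccontr)
    fix x y assume "x \<in> space N" "y \<in> space N" "e x = e y" "x \<noteq> y"
    then obtain n where "x \<in> U n" "U n \<subseteq> mball x (d x y)" using balls[of x "d x y"] M by auto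
    moreover have "e x n = e y n" using \<open>e x = e y\<close> by simp
    ultimately show False by (auto simp: e_def split: if_splits)
  qed
  have pb: "pulls_back N e borel"
  proof (rule pulls_back_sigma[OF sets])
    fix A assume "A \<in> {U. openin mtopology U}"
    then have A: "openin mtopology A" by simp
    have "{z :: nat \<Rightarrow> nat. \<exists>n. U n \<subseteq> A \<and> z n = 1} \<in> sets borel" by measurable
    moreover have "x \<in> A \<longleftrightarrow> e x \<in> {z. \<exists>n. U n \<subseteq> A \<and> z n = 1}" for x
      using base[OF A, of x] by (auto simp: e_def split: if_splits)
    ultimately show "\<exists>D\<in>sets borel. \<forall>x\<in>space N. x \<in> A \<longleftrightarrow> e x \<in> D" by blast
  qed simp
  define small where "small n k \<longleftrightarrow> (\<exists>a. U n \<subseteq> mcball a (1 / real (Suc k)))" for n k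
  \<comment> \<open>The range of \<open>e\<close>: neighbourhood filters with a basis of sets of vanishing diameter converge,
    by completeness.\<close>
  define E where "E = {z :: nat \<Rightarrow> nat. (\<forall>n. z n \<le> 1) \<and> (\<forall>k. \<exists>n. z n = 1 \<and> small n k) \<and>
    (\<forall>n m. z n = 1 \<longrightarrow> z m = 1 \<longrightarrow> (\<exists>l. z l = 1 \<and> mtopology closure_of U l \<subseteq> U n \<inter> U m)) \<and>
    (\<forall>n m. z n = 1 \<longrightarrow> U n \<subseteq> U m \<longrightarrow> z m = 1) \<and> (\<forall>n. z n = 1 \<longrightarrow> U n \<noteq> {})}"
  have E: "E \<in> sets borel" unfolding E_def by measurable
  have "e x \<in> E" if x: "x \<in> M" for x
  proof -
    have f3: "e x n \<le> 1" "e x n = 1 \<longleftrightarrow> x \<in> U n" for n by (auto simp: e_def)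
    have f1: "\<exists>n. e x n = 1 \<and> small n k" for k
    proof -
      have "0 < 1 / real (Suc k)" by simp
      from balls[OF x this] obtain n where "x \<in> U n" "U n \<subseteq> mball x (1 / real (Suc k))" by blast
      then have "e x n = 1" "U n \<subseteq> mcball x (1 / real (Suc k))"
        using mball_subset_mcball[of x "1 / real (Suc k)"] by (simp_all add: e_def)
      then have "e x n = 1 \<and> small n k" unfolding small_def by (intro conjI exI[of _ x])
      then show ?thesis ..
    qed
    have f2: "\<exists>l. e x l = 1 \<and> mtopology closure_of U l \<subseteq> U n \<inter> U m" if "e x n = 1" "e x m = 1" for n m
    proof -
      have "openin mtopology (U n \<inter> U m)" by (intro openin_Int Uo)
      moreover have "x \<in> U n \<inter> U m" using that f3(2) by blast
      ultimately have "\<exists>r>0. mball x r \<subseteq> U n \<inter> U m" unfolding openin_mtopology by (elim conjE) simp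
      then obtain r where r: "r > 0" "mball x r \<subseteq> U n \<inter> U m" by blast
      obtain l where l: "x \<in> U l" "U l \<subseteq> mball x (r / 2)" using balls[OF x half_gt_zero[OF r(1)]] by (elim exE conjE)
      have "mtopology closure_of U l \<subseteq> mcball x (r / 2)"
        using l mball_subset_mcball[of x "r / 2"] by (intro closure_of_minimal closedin_mcball) blast
      also have "\<dots> \<subseteq> mball x r" using r by (intro mcball_subset_mball_concentric) simp
      finally have "mtopology closure_of U l \<subseteq> U n \<inter> U m" using r(2) by blast
      moreover have "e x l = 1" using l(1) by (simp add: e_def)
      ultimately show ?thesis by (intro exI[of _ l] conjI)
    qed
    show ?thesis unfolding E_def mem_Collect_eq
    proof (intro conjI allI impI)
      show "e x m = 1" if "e x n = 1" "U n \<subseteq> U m" for n m using that f3(2) by blast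
      show "U n \<noteq> {}" if "e x n = 1" for n using that f3(2) by blast
      show "e x n \<le> 1" for n by (rule f3(1))
      show "\<exists>n. e x n = 1 \<and> small n k" for k by (rule f1)
      show "\<exists>l. e x l = 1 \<and> mtopology closure_of U l \<subseteq> U n \<inter> U m"
        if "e x n = 1" "e x m = 1" for n m using that by (rule f2)
    qed
  qed
  moreover have "\<exists>x\<in>M. z = e x" if z: "z \<in> E" for z
  proof -
    have sm: "\<exists>n. z n = 1 \<and> small n k" for k using z by (simp add: E_def)
    have cl: "\<exists>l. z l = 1 \<and> mtopology closure_of U l \<subseteq> U n \<inter> U m" if "z n = 1" "z m = 1" for n m
      using z that by (simp add: E_def)
    have up: "z m = 1" if "z n = 1" "U n \<subseteq> U m" for n m using z that by (auto simp: E_def)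
    have ne: "U n \<noteq> {}" if "z n = 1" for n using z that by (auto simp: E_def)
    have subcl: "U l \<subseteq> mtopology closure_of U l" for l
      using Uo closure_of_subset openin_subset by metis
    have "\<exists>l. \<forall>k. z (l k) = 1 \<and> (small (l (Suc k)) k \<and> mtopology closure_of U (l (Suc k)) \<subseteq> U (l k) \<and>
        (z k = 1 \<longrightarrow> mtopology closure_of U (l (Suc k)) \<subseteq> U k))"
    proof (rule dependent_nat_choice)
      show "\<exists>l. z l = 1" using sm by blast
      fix l k assume l: "z l = 1"
      obtain n where n: "z n = 1" "small n k" using sm by blast
      obtain l1 where l1: "z l1 = 1" "mtopology closure_of U l1 \<subseteq> U l \<inter> U n" using cl[OF l n(1)] by blast
      define k' where "k' = (if z k = 1 then k else l1)"
      have "z k' = 1" using l1(1) by (simp add: k'_def)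
      then obtain l2 where l2: "z l2 = 1" "mtopology closure_of U l2 \<subseteq> U l1 \<inter> U k'"
        using cl[OF l1(1)] by blast
      have "mtopology closure_of U l2 \<subseteq> U l \<inter> U n" using l1 l2 subcl[of l1] by blast
      moreover have "small l2 k" using n(2) calculation subcl[of l2] unfolding small_def by blast
      ultimately show "\<exists>l'. z l' = 1 \<and> (small l' k \<and> mtopology closure_of U l' \<subseteq> U l \<and>
          (z k = 1 \<longrightarrow> mtopology closure_of U l' \<subseteq> U k))"
        using l2 by (intro exI[of _ l2]) (auto simp: k'_def)
    qed
    then obtain l where l0: "\<forall>k. z (l k) = 1 \<and> (small (l (Suc k)) k \<and> mtopology closure_of U (l (Suc k)) \<subseteq> U (l k) \<and>
        (z k = 1 \<longrightarrow> mtopology closure_of U (l (Suc k)) \<subseteq> U k))" by (rule exE)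
    then have l: "\<And>k. z (l k) = 1" "\<And>k. small (l (Suc k)) k"
      "\<And>k. mtopology closure_of U (l (Suc k)) \<subseteq> U (l k)"
      "\<And>k. z k = 1 \<Longrightarrow> mtopology closure_of U (l (Suc k)) \<subseteq> U k" by simp_all
    define C where "C k = mtopology closure_of U (l k)" for k
    have "C (Suc k) \<subseteq> C k" for k using l(3)[of k] subcl[of "l k"] by (auto simp: C_def)
    then have "decseq C" by (rule decseq_SucI)
    moreover have "closedin mtopology (C k)" "C k \<noteq> {}" for k
      using ne[OF l(1)[of k]] subcl[of "l k"] by (auto simp: C_def)
    moreover have "\<exists>n a. C n \<subseteq> mcball a \<epsilon>" if \<epsilon>: "\<epsilon> > 0" for \<epsilon>
    proof -
      obtain k where k: "1 / real (Suc k) < \<epsilon>" using \<epsilon> nat_approx_posE by metis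
      obtain a where a: "U (l (Suc k)) \<subseteq> mcball a (1 / real (Suc k))"
        using l(2)[of k] by (auto simp: small_def)
      then have "C (Suc k) \<subseteq> mcball a (1 / real (Suc k))"
        unfolding C_def by (intro closure_of_minimal) auto
      also have "\<dots> \<subseteq> mcball a \<epsilon>" using k by (intro mcball_subset_concentric) simp
      finally show ?thesis by blast
    qed
    ultimately have "\<Inter> (range C) \<noteq> {}" using comp unfolding mcomplete_nest by blast
    then obtain x where x: "\<And>k. x \<in> C k" by blast
    then have xU: "x \<in> U (l k)" for k using l(3)[of k] by (auto simp: C_def)
    then have xM: "x \<in> M" using UN(2) by blast
    have "z n = 1 \<longleftrightarrow> x \<in> U n" for n
    proof
      assume "z n = 1"
      then show "x \<in> U n" using l(4) x[of "Suc n"] by (auto simp: C_def)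
    next
      assume "x \<in> U n"
      then have "\<exists>r>0. mball x r \<subseteq> U n" using Uo[of n] unfolding openin_mtopology by (elim conjE) simp
      then obtain r where r: "r > 0" "mball x r \<subseteq> U n" by blast
      obtain k where k: "1 / real (Suc k) < r / 2" using r nat_approx_posE by (metis half_gt_zero)
      obtain a where a: "U (l (Suc k)) \<subseteq> mcball a (1 / real (Suc k))"
        using l(2)[of k] by (auto simp: small_def)
      have "U (l (Suc k)) \<subseteq> mball x r"
      proof
        fix y assume "y \<in> U (l (Suc k))"
        then have y: "a \<in> M" "y \<in> M" "d a y \<le> 1 / real (Suc k)" "d a x \<le> 1 / real (Suc k)"
          using a xU[of "Suc k"] by auto
        then have "d x y \<le> d a x + d a y" using triangle[of x a y] xM commute[of x a] by simp
        then show "y \<in> mball x r" using y xM k by simp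
      qed
      then show "z n = 1" using up[OF l(1)] r by blast
    qed
    moreover have "z n \<le> 1" for n using z by (simp add: E_def)
    ultimately have "z n = e x n" for n by (metis e_def le_neq_implies_less less_one)
    then show ?thesis using xM by auto
  qed
  ultimately have "e ` space N = E" using M by auto
  then show ?thesis using em inj pb E by (intro bexI[of _ e]) (auto simp: e_def)
qed

lemma metrizable_euclidean_prod:
  assumes "metrizable_space (euclidean :: 'a::topological_space topology)"
    "metrizable_space (euclidean :: 'b::topological_space topology)"
  shows "metrizable_space (euclidean :: ('a \<times> 'b) topology)"
  using assms unfolding prod_topology_euclidean[symmetric] metrizable_space_prod_topology by blast

lemma metrizable_fun_nat: "metrizable_space (euclidean :: ('i::countable \<Rightarrow> nat) topology)"
  using completely_metrizable_fun_nat by (rule completely_metrizable_imp_metrizable_space)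

lemma closed_interleave:
  fixes F :: "(((nat \<Rightarrow> nat) \<times> (nat \<Rightarrow> nat)) \<times> (nat \<Rightarrow> nat) \<times> (nat \<Rightarrow> nat)) set"
  assumes "closed F"
  shows "closed {(a, b, \<alpha>). ((a, b), (\<lambda>n. \<alpha> (2 * n)), (\<lambda>n. \<alpha> (2 * n + 1))) \<in> F}"
proof -
  have "continuous_on UNIV (\<lambda>p :: (nat \<Rightarrow> nat) \<times> (nat \<Rightarrow> nat) \<times> (nat \<Rightarrow> nat).
      ((fst p, fst (snd p)), (\<lambda>n. snd (snd p) (2 * n)), (\<lambda>n. snd (snd p) (2 * n + 1))))"
    by (intro continuous_on_Pair continuous_on_coordinatewise_then_product continuous_on_fst
        continuous_on_snd continuous_on_id
        continuous_on_product_then_coordinatewise[OF continuous_on_snd[OF continuous_on_snd]])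
  from closed_vimage[OF assms this] show ?thesis
    by (simp add: vimage_def case_prod_unfold)
qed

lemma closed_diag:
  "closed {(x :: nat \<Rightarrow> nat, y, \<alpha> :: nat \<Rightarrow> nat). x = y \<and> (\<forall>i. x i \<le> 1)}"
proof -
  have c: "continuous_on UNIV (\<lambda>p :: (nat \<Rightarrow> nat) \<times> (nat \<Rightarrow> nat) \<times> (nat \<Rightarrow> nat). fst p i)"
    "continuous_on UNIV (\<lambda>p :: (nat \<Rightarrow> nat) \<times> (nat \<Rightarrow> nat) \<times> (nat \<Rightarrow> nat). fst (snd p) i)" for i
    by (intro continuous_on_product_then_coordinatewise[OF continuous_on_fst]
        continuous_on_product_then_coordinatewise[OF continuous_on_fst[OF continuous_on_snd]] continuous_on_id)+
  have "closed (\<Inter>i. {p :: (nat \<Rightarrow> nat) \<times> (nat \<Rightarrow> nat) \<times> (nat \<Rightarrow> nat). fst p i = fst (snd p) i} \<inter> {p. fst p i \<le> 1})"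
    by (intro closed_INT ballI closed_Int closed_Collect_eq closed_Collect_le c continuous_on_const)
  also have "(\<Inter>i. {p :: (nat \<Rightarrow> nat) \<times> (nat \<Rightarrow> nat) \<times> (nat \<Rightarrow> nat). fst p i = fst (snd p) i} \<inter> {p. fst p i \<le> 1}) =
      {(x, y, \<alpha>). x = y \<and> (\<forall>i. x i \<le> 1)}"
    by (auto simp: fun_eq_iff)
  finally show ?thesis .
qed

lemma closed_code_of_analytic:
  fixes N :: "'a measure"
  assumes sb: "standard_borel N" and qo: "analytic_quasi_order N R"
  obtains e :: "'a \<Rightarrow> nat \<Rightarrow> nat" and C where
    "e \<in> borel_measurable N" "\<And>x i. e x i \<le> 1" "inj_on e (space N)" "e ` space N \<in> sets borel"
    "pulls_back N e borel" "closed_code C"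
    "\<And>x y. x \<in> space N \<Longrightarrow> y \<in> space N \<Longrightarrow> (x, y) \<in> R \<longleftrightarrow> (\<exists>\<alpha>. (e x, e y, \<alpha>) \<in> C)"
proof -
  obtain e :: "'a \<Rightarrow> nat \<Rightarrow> nat" where e: "e \<in> borel_measurable N" "\<And>x i. e x i \<le> 1" "inj_on e (space N)"
    and E: "e ` space N \<in> sets borel" and pb: "pulls_back N e borel"
    using standard_borel_code[OF sb] by (elim bexE conjE) blast
  have R: "R \<subseteq> space N \<times> space N" "refl_on (space N) R" "trans R"
    using qo by (auto simp: analytic_quasi_order_def preorder_on_def)
  obtain B where B: "B \<in> sets ((N \<Otimes>\<^sub>M N) \<Otimes>\<^sub>M (borel :: (nat \<Rightarrow> nat) measure))" "R = fst ` B"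
    using qo by (auto simp: analytic_quasi_order_def analytic_in_def)
  have "pulls_back ((N \<Otimes>\<^sub>M N) \<Otimes>\<^sub>M (borel :: (nat \<Rightarrow> nat) measure)) (map_prod (map_prod e e) (\<lambda>x. x))
      ((borel \<Otimes>\<^sub>M borel) \<Otimes>\<^sub>M borel)"
    by (intro pulls_back_pair pb pulls_back_id) (simp_all add: space_pair_measure)
  then obtain D where D: "D \<in> sets ((borel \<Otimes>\<^sub>M borel) \<Otimes>\<^sub>M (borel :: (nat \<Rightarrow> nat) measure))"
    "\<forall>p\<in>space ((N \<Otimes>\<^sub>M N) \<Otimes>\<^sub>M (borel :: (nat \<Rightarrow> nat) measure)). p \<in> B \<longleftrightarrow> map_prod (map_prod e e) (\<lambda>x. x) p \<in> D"
    using B(1) unfolding pulls_back_def by blast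
  define D' where "D' = D \<inter> ((e ` space N \<times> e ` space N) \<times> UNIV)"
  have "(e ` space N \<times> e ` space N) \<times> UNIV \<in> sets ((borel \<Otimes>\<^sub>M borel) \<Otimes>\<^sub>M (borel :: (nat \<Rightarrow> nat) measure))"
    by (intro pair_measureI E) simp
  then have "D' \<in> sets ((borel \<Otimes>\<^sub>M borel) \<Otimes>\<^sub>M borel)" unfolding D'_def using D(1) by (intro sets.Int)
  then have "D' \<in> sets borel" by (simp only: borel_prod)
  then have "proj_closed D'"
    by (intro proj_closed_borel metrizable_euclidean_prod metrizable_fun_nat)
  then obtain F where "closed F \<and> D' = {z. \<exists>\<gamma>::nat \<Rightarrow> nat. (z, \<gamma>) \<in> F}"
    unfolding proj_closed_def by (rule exE)
  then have F: "closed F" "D' = {z. \<exists>\<gamma>. (z, \<gamma>) \<in> F}" by simp_all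
  define F' where "F' = (\<lambda>q. ((fst q, fst (snd q)), snd (snd q))) -` F"
  have "closed F'" unfolding F'_def using F(1) by (rule closed_vimage) (intro continuous_intros)
  define C0 where "C0 = {(a, b, \<alpha>). ((a, b), (\<lambda>n. \<alpha> (2 * n)), (\<lambda>n. \<alpha> (2 * n + 1))) \<in> F'}"
  have C0: "(\<exists>\<alpha>. (a, b, \<alpha>) \<in> C0) \<longleftrightarrow> (\<exists>x y. a = e x \<and> b = e y \<and> (x, y) \<in> R)" for a b
  proof
    assume "\<exists>\<alpha>. (a, b, \<alpha>) \<in> C0"
    then obtain \<beta> where "((a, b), \<beta>) \<in> D'" unfolding C0_def F'_def F(2) by auto
    then obtain x y where xy: "a = e x" "b = e y" "x \<in> space N" "y \<in> space N" "((e x, e y), \<beta>) \<in> D"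
      unfolding D'_def by auto
    then have "((x, y), \<beta>) \<in> B" using D(2) by (auto simp: space_pair_measure)
    then have "(x, y) \<in> R" unfolding B(2) by force
    then show "\<exists>x y. a = e x \<and> b = e y \<and> (x, y) \<in> R" using xy by blast
  next
    assume "\<exists>x y. a = e x \<and> b = e y \<and> (x, y) \<in> R"
    then obtain x y where xy: "a = e x" "b = e y" "(x, y) \<in> R" by blast
    then obtain \<beta> where "((x, y), \<beta>) \<in> B" unfolding B(2) by auto
    moreover have "x \<in> space N" "y \<in> space N" using xy R(1) by auto
    ultimately have "((a, b), \<beta>) \<in> D'" using D(2) xy by (auto simp: D'_def space_pair_measure)
    then obtain \<gamma> where g: "(((a, b), \<beta>), \<gamma>) \<in> F" using F(2) by blast
    define \<alpha> where "\<alpha> n = (if even n then \<beta> (n div 2) else \<gamma> (n div 2))" for n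
    have "(\<lambda>n. \<alpha> (2 * n)) = \<beta>" "(\<lambda>n. \<alpha> (2 * n + 1)) = \<gamma>" by (auto simp: \<alpha>_def)
    then have "(a, b, \<alpha>) \<in> C0" using g unfolding C0_def F'_def by simp
    then show "\<exists>\<alpha>. (a, b, \<alpha>) \<in> C0" by (intro exI[of _ \<alpha>])
  qed
  \<comment> \<open>The diagonal makes the code reflexive on all 0-1 sequences, also those outside the range of \<open>e\<close>;
    finite approximations cannot tell them apart.\<close>
  define C where "C = C0 \<union> {(x, y, \<alpha>). x = y \<and> (\<forall>i. x i \<le> 1)}"
  have C: "(\<exists>\<alpha>. (a, b, \<alpha>) \<in> C) \<longleftrightarrow> (\<exists>x y. a = e x \<and> b = e y \<and> (x, y) \<in> R) \<or> a = b \<and> (\<forall>i. a i \<le> 1)" for a b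
    unfolding C_def C0[symmetric] by auto
  have "closed_code C"
  proof
    show "closed C" unfolding C_def C0_def
      by (intro closed_Un closed_interleave closed_diag \<open>closed F'\<close>)
    show "x i \<le> 1 \<and> y i \<le> 1" if "(x, y, \<alpha>) \<in> C" for x y \<alpha> i
    proof -
      have "(\<exists>u v. x = e u \<and> y = e v \<and> (u, v) \<in> R) \<or> x = y \<and> (\<forall>i. x i \<le> 1)"
        using that C[of x y] by blast
      then show ?thesis using e(2) by auto
    qed
    show "(x, x, \<alpha>) \<in> C" if "\<And>i. x i \<le> 1" for x \<alpha> using that by (simp add: C_def)
    show "\<exists>\<gamma>. (x, z, \<gamma>) \<in> C" if xy: "(x, y, \<alpha>) \<in> C" and yz: "(y, z, \<beta>) \<in> C" for x y z \<alpha> \<beta>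
    proof -
      have 1: "(\<exists>u v. x = e u \<and> y = e v \<and> (u, v) \<in> R) \<or> x = y"
        "(\<exists>u v. y = e u \<and> z = e v \<and> (u, v) \<in> R) \<or> y = z"
        using xy yz C[of x y] C[of y z] by blast+
      consider "x = y" | "y = z" | u v v' w where "x = e u" "y = e v" "(u, v) \<in> R" "y = e v'" "z = e w" "(v', w) \<in> R"
        using 1 by blast
      then show ?thesis
      proof cases
        case 3
        then have "v = v'" using e(3) R(1) by (auto dest: inj_onD)
        then have "(u, w) \<in> R" using 3 R(3) by (auto dest: transD)
        then show ?thesis using 3 C[of x z] by blast
      qed (use xy yz in blast)+
    qed
  qed
  moreover have "(x, y) \<in> R \<longleftrightarrow> (\<exists>\<alpha>. (e x, e y, \<alpha>) \<in> C)" if xy: "x \<in> space N" "y \<in> space N" for x y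
  proof
    assume "\<exists>\<alpha>. (e x, e y, \<alpha>) \<in> C"
    then consider u v where "e x = e u" "e y = e v" "(u, v) \<in> R" | "e x = e y"
      unfolding C by blast
    then show "(x, y) \<in> R"
    proof cases
      case 1
      then have "u = x" "v = y" using e(3) xy R(1) by (auto dest: inj_onD)
      then show ?thesis using 1 by simp
    next
      case 2
      then have "x = y" using e(3) xy by (auto dest: inj_onD)
      then show ?thesis using R(2) xy by (simp add: refl_onD)
    qed
  qed (use C[of "e x" "e y"] in blast)
  ultimately show thesis using that e E pb by blast
qed

section \<open>Colourings coding a point\<close>

definition marker :: "nat list \<Rightarrow> nat" where
  "marker \<tau> = to_nat (Inl \<tau> :: nat list + nat list)"

definition label :: "nat list \<Rightarrow> nat" where
  "label u = to_nat (Inr u :: nat list + nat list)"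

lemma marker_label [simp]: "marker \<tau> = marker \<tau>' \<longleftrightarrow> \<tau> = \<tau>'" "label u = label v \<longleftrightarrow> u = v" "marker \<tau> \<noteq> label u" "label u \<noteq> marker \<tau>"
  by (simp_all add: marker_def label_def)

definition block_colours :: "((nat \<Rightarrow> nat) \<times> (nat \<Rightarrow> nat) \<times> (nat \<Rightarrow> nat)) set \<Rightarrow> (nat \<Rightarrow> nat) \<Rightarrow> nat list \<Rightarrow> nat set" where
  "block_colours C x \<sigma> = marker ` {\<tau>. list_all2 (\<le>) \<tau> \<sigma>} \<union>
     label ` {u. \<sigma> \<noteq> [] \<and> length u = length \<sigma> \<and> linked C (length \<sigma>) ((!) u) x ((!) \<sigma>)}"

lemma marker_in_block_colours: "marker \<tau> \<in> block_colours C x \<sigma> \<longleftrightarrow> list_all2 (\<le>) \<tau> \<sigma>"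
  and label_in_block_colours: "label u \<in> block_colours C x \<sigma> \<longleftrightarrow>
    \<sigma> \<noteq> [] \<and> length u = length \<sigma> \<and> linked C (length \<sigma>) ((!) u) x ((!) \<sigma>)"
  by (auto simp: block_colours_def)

lemma block_colours_cases:
  assumes "k \<in> block_colours C x \<sigma>"
  obtains \<tau> where "k = marker \<tau>" "list_all2 (\<le>) \<tau> \<sigma>"
  | u where "k = label u" "\<sigma> \<noteq> []" "length u = length \<sigma>" "linked C (length \<sigma>) ((!) u) x ((!) \<sigma>)"
  using assms by (auto simp: block_colours_def)

lemma block_colours_level: "k \<in> block_colours C x \<sigma> \<Longrightarrow> k \<in> block_colours C y \<tau> \<Longrightarrow> length \<sigma> = length \<tau>"
  by (auto simp: block_colours_def dest!: list_all2_lengthD)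

lemma marker_self_in_block_colours: "marker \<sigma> \<in> block_colours C x \<sigma>"
  by (simp add: marker_in_block_colours list_all2_refl)

fun shift :: "(nat \<Rightarrow> nat) \<Rightarrow> nat list \<Rightarrow> nat list" where
  "shift \<beta> [] = []"
| "shift \<beta> (a # \<sigma>) = (a + \<beta> 0) # shift (\<lambda>i. \<beta> (Suc i)) \<sigma>"

lemma length_shift [simp]: "length (shift \<beta> \<sigma>) = length \<sigma>"
  by (induction \<sigma> arbitrary: \<beta>) auto

lemma nth_shift: "i < length \<sigma> \<Longrightarrow> shift \<beta> \<sigma> ! i = \<sigma> ! i + \<beta> i"
  by (induction \<sigma> arbitrary: \<beta> i) (auto simp: nth_Cons split: nat.splits)

lemma shift_less: "\<sigma> < \<tau> \<Longrightarrow> shift \<beta> \<sigma> < shift \<beta> \<tau>"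
proof (induction \<sigma> arbitrary: \<beta> \<tau>)
  case Nil
  then show ?case by (cases \<tau>) auto
next
  case (Cons a \<sigma>)
  then show ?case by (cases \<tau>) auto
qed

lemma strict_mono_shift: "strict_mono (shift \<beta>)"
  by (intro strict_monoI shift_less)

lemma linked_Suc:
  assumes "linked C (Suc n) x y \<beta>"
  shows "linked C n x y \<beta>"
proof -
  have ag: "agree n u v" if "agree (Suc n) u v" for u v :: "nat \<Rightarrow> nat"
    using that by (simp add: agree_def)
  obtain w where w: "agree (Suc n) (w 0) x" "agree (Suc n) (w (\<beta> 0)) y"
    "\<And>j. j < \<beta> 0 \<Longrightarrow> \<exists>a b \<alpha>. (a, b, \<alpha>) \<in> C \<and> agree (Suc n) a (w j) \<and> agree (Suc n) b (w (Suc j)) \<and>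
       (\<forall>i<Suc n. \<alpha> i \<le> \<beta> i)"
    using assms unfolding linked_def by blast
  have "\<exists>a b \<alpha>. (a, b, \<alpha>) \<in> C \<and> agree n a (w j) \<and> agree n b (w (Suc j)) \<and> (\<forall>i<n. \<alpha> i \<le> \<beta> i)"
    if "j < \<beta> 0" for j
    using w(3)[OF that] ag less_SucI by blast
  then show ?thesis unfolding linked_def using w(1,2) ag by blast
qed

context closed_code
begin

lemma block_colours_shift:
  assumes "\<And>n. linked C n x y \<beta>"
  shows "block_colours C x \<sigma> \<subseteq> block_colours C y (shift \<beta> \<sigma>)"
proof
  fix k assume "k \<in> block_colours C x \<sigma>"
  then show "k \<in> block_colours C y (shift \<beta> \<sigma>)"
  proof (cases rule: block_colours_cases)
    case (1 \<tau>)
    then show ?thesis by (auto simp: marker_in_block_colours list_all2_conv_all_nth nth_shift trans_le_add1)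
  next
    case (2 u)
    have "linked C (length \<sigma>) ((!) u) y (\<lambda>i. \<sigma> ! i + \<beta> i)"
      by (rule linked_trans[OF 2(4) assms])
    moreover have "agree (length \<sigma>) (\<lambda>i. \<sigma> ! i + \<beta> i) ((!) (shift \<beta> \<sigma>))"
      by (simp add: agree_def nth_shift)
    ultimately have "linked C (length \<sigma>) ((!) u) y ((!) (shift \<beta> \<sigma>))"
      using 2(2) linked_cong[of "length \<sigma>" "(!) u" "(!) u" y y] by simp
    moreover have "shift \<beta> \<sigma> \<noteq> []" using 2(2) by (metis length_0_conv length_shift)
    ultimately show ?thesis using 2 by (simp add: label_in_block_colours)
  qed
qed

lemma block_colours_mono:
  assumes x: "\<And>i. x i \<le> 1" and le: "list_all2 (\<le>) \<sigma> \<tau>"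
  shows "block_colours C x \<sigma> \<subseteq> block_colours C x \<tau>"
proof -
  define \<delta> where "\<delta> i = \<tau> ! i - \<sigma> ! i" for i
  have "shift \<delta> \<sigma> = \<tau>"
    using le by (intro nth_equalityI) (auto simp: list_all2_conv_all_nth nth_shift \<delta>_def)
  then show ?thesis using block_colours_shift[of x x \<delta> \<sigma>] linked_refl[OF x] by simp
qed

lemma label_in_block_colours_zero:
  assumes x: "\<And>i. x i \<le> 1"
  shows "label u \<in> block_colours C x (replicate (Suc n) 0) \<longleftrightarrow> u = map x [0..<Suc n]"
proof
  assume "label u \<in> block_colours C x (replicate (Suc n) 0)"
  then have u: "length u = Suc n" "linked C (Suc n) ((!) u) x ((!) (replicate (Suc n) 0))"
    unfolding label_in_block_colours by simp_all
  have "agree (Suc n) ((!) u) x" by (rule linked_zero[OF _ u(2)]) simp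
  then show "u = map x [0..<Suc n]"
    using u(1) by (intro nth_equalityI) (auto simp: agree_def simp del: upt_Suc)
next
  assume u: "u = map x [0..<Suc n]"
  have "agree (Suc n) ((!) u) x" by (auto simp: u agree_def simp del: upt_Suc)
  then have "linked C (Suc n) ((!) u) x ((!) (replicate (Suc n) 0))"
    using linked_refl[OF x, of "Suc n"]
      linked_cong[of "Suc n" "(!) u" x x x "(!) (replicate (Suc n) 0)" "(!) (replicate (Suc n) 0)" C]
    by simp
  then show "label u \<in> block_colours C x (replicate (Suc n) 0)" unfolding label_in_block_colours u by simp
qed

lemma embed_iff_code:
  assumes x: "\<And>i. x i \<le> 1" and y: "\<And>i. y i \<le> 1"
    and c: "realizes c (block_colours C x) b" and c': "realizes c' (block_colours C y) b'"
  shows "(c, c') \<in> rat_coloring_embed \<longleftrightarrow> (\<exists>\<alpha>. (x, y, \<alpha>) \<in> C)"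
proof
  assume emb: "(c, c') \<in> rat_coloring_embed"
  have "\<exists>\<beta>. \<forall>n>0. block_colours C x (replicate n 0) \<subseteq> block_colours C y (map \<beta> [0..<n])"
  proof (rule branch_of_embed[OF c c' _ _ _ emb])
    show "length \<sigma> = length \<tau>" if "k \<in> block_colours C x \<sigma>" "k \<in> block_colours C y \<tau>" for k \<sigma> \<tau>
      using that by (rule block_colours_level)
    show "block_colours C x \<sigma> \<subseteq> block_colours C x \<tau>" if "list_all2 (\<le>) \<sigma> \<tau>" for \<sigma> \<tau> using x that by (rule block_colours_mono)
    show "block_colours C y \<sigma> \<subseteq> block_colours C y \<tau>" if "list_all2 (\<le>) \<sigma> \<tau>" for \<sigma> \<tau> using y that by (rule block_colours_mono)
  qed
  then obtain \<beta> where \<beta>: "\<And>n. n > 0 \<Longrightarrow> block_colours C x (replicate n 0) \<subseteq> block_colours C y (map \<beta> [0..<n])" by blast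
  have "linked C (Suc n) x y \<beta>" for n
  proof -
    define u \<sigma> where "u = map x [0..<Suc n]" and "\<sigma> = map \<beta> [0..<Suc n]"
    have "label u \<in> block_colours C y \<sigma>"
      using \<beta>[of "Suc n"] label_in_block_colours_zero[where x = x and u = u and n = n, OF x] unfolding u_def \<sigma>_def by blast
    then have "linked C (Suc n) ((!) u) y ((!) \<sigma>)" by (simp add: label_in_block_colours \<sigma>_def del: upt_Suc)
    moreover have "agree (Suc n) ((!) u) x" "agree (Suc n) ((!) \<sigma>) \<beta>"
      by (auto simp: u_def \<sigma>_def agree_def simp del: upt_Suc)
    ultimately show ?thesis using linked_cong[of "Suc n" "(!) u" x y y "(!) \<sigma>" \<beta> C] by simp
  qed
  then show "\<exists>\<alpha>. (x, y, \<alpha>) \<in> C" using linked_Suc by (intro code_of_linked[of x y \<beta>] x) blast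
next
  assume "\<exists>\<alpha>. (x, y, \<alpha>) \<in> C"
  then obtain \<beta> where "\<And>n. linked C n x y \<beta>" using linked_of_code by blast
  from block_colours_shift[OF this] show "(c, c') \<in> rat_coloring_embed"
    by (rule embed_of_realizes[OF c c' strict_mono_shift])
qed

end

text \<open>
  One-sided, since a block may have a least but never a greatest element.
\<close>

definition germ :: "(rat \<Rightarrow> nat) \<Rightarrow> rat \<Rightarrow> nat list \<Rightarrow> bool" where
  "germ c q \<sigma> \<longleftrightarrow> (\<exists>r>q. \<forall>s. q < s \<longrightarrow> s < r \<longrightarrow>
     (\<forall>\<tau>. (\<exists>t. q < t \<and> t < s \<and> c t = marker \<tau>) \<longleftrightarrow> list_all2 (\<le>) \<tau> \<sigma>))"

lemma germ_unique:
  assumes "germ c q \<sigma>" "germ c q \<sigma>'"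
  shows "\<sigma> = \<sigma>'"
proof -
  obtain r where r: "q < r" "\<And>s \<tau>. q < s \<Longrightarrow> s < r \<Longrightarrow>
      (\<exists>t. q < t \<and> t < s \<and> c t = marker \<tau>) \<longleftrightarrow> list_all2 (\<le>) \<tau> \<sigma>"
    using assms(1) unfolding germ_def by blast
  obtain r' where r': "q < r'" "\<And>s \<tau>. q < s \<Longrightarrow> s < r' \<Longrightarrow>
      (\<exists>t. q < t \<and> t < s \<and> c t = marker \<tau>) \<longleftrightarrow> list_all2 (\<le>) \<tau> \<sigma>'"
    using assms(2) unfolding germ_def by blast
  obtain s where s: "q < s" "s < min r r'" using dense[of q "min r r'"] r(1) r'(1) by auto
  have eq: "list_all2 (\<le>) \<tau> \<sigma> \<longleftrightarrow> list_all2 (\<le>) \<tau> \<sigma>'" for \<tau>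
    using r(2)[of s \<tau>] r'(2)[of s \<tau>] s by simp
  have "list_all2 (\<le>) \<sigma> \<sigma>'" "list_all2 (\<le>) \<sigma>' \<sigma>"
    using eq[of \<sigma>] eq[of \<sigma>'] by (simp_all add: list_all2_refl)
  then show ?thesis
    by (intro nth_equalityI) (auto simp: list_all2_conv_all_nth intro: antisym)
qed

lemma germ_of_realizes:
  assumes c: "realizes c (block_colours C x) b"
  shows "germ c q \<sigma> \<longleftrightarrow> b q = \<sigma>"
proof -
  have "germ c q (b q)"
  proof -
    have mb: "mono b" and bc: "\<And>t. c t \<in> block_colours C x (b t)" using c by (auto simp: realizes_def)
    have "\<exists>r>q. b r = b q" using c unfolding realizes_def by simp
    then obtain r where r: "q < r" "b r = b q" by blast
    have bt: "b t = b q" if "q \<le> t" "t \<le> r" for t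
      using monoD[OF mb that(1)] monoD[OF mb that(2)] r(2) by simp
    have "(\<exists>t. q < t \<and> t < s \<and> c t = marker \<tau>) \<longleftrightarrow> list_all2 (\<le>) \<tau> (b q)" if s: "q < s" "s < r" for s \<tau>
    proof
      assume "\<exists>t. q < t \<and> t < s \<and> c t = marker \<tau>"
      then obtain t where t: "q < t" "t < s" "c t = marker \<tau>" by blast
      then have "marker \<tau> \<in> block_colours C x (b q)" using bc[of t] bt[of t] s by simp
      then show "list_all2 (\<le>) \<tau> (b q)" by (simp add: marker_in_block_colours)
    next
      assume "list_all2 (\<le>) \<tau> (b q)"
      then have "marker \<tau> \<in> block_colours C x (b q)" by (simp add: marker_in_block_colours)
      moreover have "b q = b s" using bt[of s] s by simp
      ultimately show "\<exists>t. q < t \<and> t < s \<and> c t = marker \<tau>"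
        using realizes_dense[OF c s(1), of "marker \<tau>"] by blast
    qed
    then show ?thesis unfolding germ_def using r(1) by (intro exI[of _ r]) simp
  qed
  then show ?thesis using germ_unique[of c q \<sigma> "b q"] by auto
qed

text \<open>
  The only chain of length \<open>0\<close> is the trivial one, so in the block of \<open>0\<^sup>n\<close> the only label is the
  restriction of \<open>x\<close> to \<open>n\<close>.
\<close>

definition decode :: "(rat \<Rightarrow> nat) \<Rightarrow> nat \<Rightarrow> nat" where
  "decode c n = (LEAST k. \<exists>q u. germ c q (replicate (Suc n) 0) \<and> c q = label u \<and> u ! n = k)"

lemma (in closed_code) decode_of_realizes:
  assumes x: "\<And>i. x i \<le> 1" and c: "realizes c (block_colours C x) b"
  shows "decode c = x"
proof
  fix n
  have "(\<exists>q u. germ c q (replicate (Suc n) 0) \<and> c q = label u \<and> u ! n = k) \<longleftrightarrow> k = x n" for k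
  proof
    assume "\<exists>q u. germ c q (replicate (Suc n) 0) \<and> c q = label u \<and> u ! n = k"
    then obtain q u where q: "b q = replicate (Suc n) 0" "c q = label u" "u ! n = k"
      unfolding germ_of_realizes[OF c] by blast
    have "c q \<in> block_colours C x (b q)" using c by (simp add: realizes_def)
    then have "u = map x [0..<Suc n]" unfolding q by (simp only: label_in_block_colours_zero[where x = x, OF x])
    then show "k = x n" using q(3) by (simp del: upt_Suc)
  next
    assume k: "k = x n"
    define u where "u = map x [0..<Suc n]"
    obtain p where p: "b p = replicate (Suc n) 0" using c unfolding realizes_def surj_def by metis
    have "\<exists>r>p. b r = b p" using c unfolding realizes_def by simp
    then obtain r where r: "p < r" "b p = b r" by auto
    have "label u \<in> block_colours C x (b p)" unfolding p using label_in_block_colours_zero[where x = x, OF x] by (simp add: u_def del: upt_Suc)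
    then obtain t where t: "p < t" "t < r" "c t = label u" using realizes_dense[OF c r] by blast
    have "mono b" using c by (simp add: realizes_def)
    then have "b p \<le> b t" "b t \<le> b r" using t by (auto intro: monoD)
    then have "b t = replicate (Suc n) 0" using r p by simp
    moreover have "u ! n = k" by (simp add: u_def k del: upt_Suc)
    ultimately show "\<exists>q u. germ c q (replicate (Suc n) 0) \<and> c q = label u \<and> u ! n = k"
      unfolding germ_of_realizes[OF c] using t(3) by blast
  qed
  then have "decode c n = (LEAST k. k = x n)" unfolding decode_def by presburger
  also have "\<dots> = x n" by (rule Least_equality) auto
  finally show "decode c n = x n" .
qed

definition coded :: "((nat \<Rightarrow> nat) \<times> (nat \<Rightarrow> nat) \<times> (nat \<Rightarrow> nat)) set \<Rightarrow> (nat \<Rightarrow> nat) set \<Rightarrow> (rat \<Rightarrow> nat) set" where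
  "coded C E = {c. decode c \<in> E \<and> (\<forall>q. \<exists>\<sigma>. germ c q \<sigma>) \<and>
     (\<forall>q q' \<sigma> \<sigma>'. q \<le> q' \<longrightarrow> germ c q \<sigma> \<longrightarrow> germ c q' \<sigma>' \<longrightarrow> \<sigma> \<le> \<sigma>') \<and>
     (\<forall>\<sigma>. \<exists>q. germ c q \<sigma>) \<and> (\<forall>q. \<exists>r. q < r \<and> (\<exists>\<sigma>. germ c q \<sigma> \<and> germ c r \<sigma>)) \<and>
     (\<forall>q \<sigma> k. germ c q \<sigma> \<longrightarrow> c q = k \<longrightarrow> k \<in> block_colours C (decode c) \<sigma>) \<and>
     (\<forall>p r \<sigma> k. p < r \<longrightarrow> germ c p \<sigma> \<longrightarrow> germ c r \<sigma> \<longrightarrow> k \<in> block_colours C (decode c) \<sigma> \<longrightarrow>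
        (\<exists>t. p < t \<and> t < r \<and> c t = k))}"

lemma realizes_of_coded:
  assumes "c \<in> coded C E"
  shows "decode c \<in> E" "\<exists>b. realizes c (block_colours C (decode c)) b"
proof -
  note c = assms[unfolded coded_def mem_Collect_eq]
  show "decode c \<in> E" using c by (elim conjE)
  have "\<forall>q. \<exists>\<sigma>. germ c q \<sigma>" using c by (elim conjE)
  from choice[OF this] obtain b where b: "\<forall>q. germ c q (b q)" ..
  have g: "germ c q \<sigma> \<longleftrightarrow> b q = \<sigma>" for q \<sigma>
    using b[rule_format, of q] germ_unique[of c q \<sigma> "b q"] by auto
  note c' = c[unfolded g]
  have mono: "\<forall>q q' \<sigma> \<sigma>'. q \<le> q' \<longrightarrow> b q = \<sigma> \<longrightarrow> b q' = \<sigma>' \<longrightarrow> \<sigma> \<le> \<sigma>'"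
    and surj: "\<forall>\<sigma>. \<exists>q. b q = \<sigma>" and right: "\<forall>q. \<exists>r. q < r \<and> (\<exists>\<sigma>. b q = \<sigma> \<and> b r = \<sigma>)"
    and block_colours: "\<forall>q \<sigma> k. b q = \<sigma> \<longrightarrow> c q = k \<longrightarrow> k \<in> block_colours C (decode c) \<sigma>"
    and dense: "\<forall>p r \<sigma> k. p < r \<longrightarrow> b p = \<sigma> \<longrightarrow> b r = \<sigma> \<longrightarrow> k \<in> block_colours C (decode c) \<sigma> \<longrightarrow>
        (\<exists>t. p < t \<and> t < r \<and> c t = k)"
    using c' by - (elim conjE, assumption)+
  have "realizes c (block_colours C (decode c)) b" unfolding realizes_def
  proof (intro conjI)
    show "mono b" using mono by (intro monoI) simp
    show "surj b" using surj by (simp add: surj_def) metis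
    show "\<forall>q. c q \<in> block_colours C (decode c) (b q)" using block_colours by simp
    show "\<forall>q. \<exists>r>q. b r = b q" using right by auto
    show "\<forall>p r. p < r \<longrightarrow> b p = b r \<longrightarrow> (\<forall>k\<in>block_colours C (decode c) (b p). \<exists>t. p < t \<and> t < r \<and> c t = k)"
      using dense by simp
  qed
  then show "\<exists>b. realizes c (block_colours C (decode c)) b" by (intro exI[of _ b])
qed

lemma (in closed_code) coded_of_realizes:
  assumes x: "\<And>i. x i \<le> 1" "x \<in> E" and c: "realizes c (block_colours C x) b"
  shows "c \<in> coded C E"
  unfolding coded_def mem_Collect_eq germ_of_realizes[OF c] decode_of_realizes[OF x(1) c]
proof (intro conjI allI impI)
  show "x \<in> E" by (rule x(2))
  have mb: "mono b" and sb: "surj b" and bc: "\<And>q. c q \<in> block_colours C x (b q)" and rb: "\<And>q. \<exists>r>q. b r = b q"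
    using c unfolding realizes_def by auto
  show "\<exists>\<sigma>. b q = \<sigma>" for q by simp
  show "\<exists>q. b q = \<sigma>" for \<sigma> using sb by (metis surjD)
  show "\<sigma> \<le> \<sigma>'" if "q \<le> q'" "b q = \<sigma>" "b q' = \<sigma>'" for q q' \<sigma> \<sigma>' using that monoD[OF mb] by blast
  show "\<exists>r. q < r \<and> (\<exists>\<sigma>. b q = \<sigma> \<and> b r = \<sigma>)" for q using rb[of q] by blast
  show "k \<in> block_colours C x \<sigma>" if "b q = \<sigma>" "c q = k" for q \<sigma> k using bc[of q] that by simp
  show "\<exists>t. p < t \<and> t < r \<and> c t = k" if "p < r" "b p = \<sigma>" "b r = \<sigma>" "k \<in> block_colours C x \<sigma>" for p r \<sigma> k
  proof -
    have "b p = b r" "k \<in> block_colours C x (b p)" using that by simp_all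
    from realizes_dense[OF c that(1) this] show ?thesis by blast
  qed
qed

lemma realizes_iso:
  assumes c: "realizes c A b" and "(c, c') \<in> rat_coloring_iso"
  shows "\<exists>b'. realizes c' A b'"
proof -
  obtain h where h: "bij h" "strict_mono h" "\<And>q. c q = c' (h q)"
    using assms(2) by (auto simp: rat_coloring_iso_def)
  define g where "g = inv h"
  have hg: "h (g q) = q" "g (h q) = q" for q
    using h(1) by (simp_all add: g_def bij_is_surj surj_f_inv_f bij_is_inj)
  have less: "g p < g q \<longleftrightarrow> p < q" for p q using strict_mono_less[OF h(2), of "g p" "g q"] by (simp add: hg)
  have cg: "c' q = c (g q)" for q by (simp add: h(3) hg)
  have le: "g p \<le> g q" if "p \<le> q" for p q using that less[of q p] by auto
  have "mono b" "surj b" and bc: "\<And>q. c q \<in> A (b q)" and rb: "\<And>q. \<exists>r>q. b r = b q"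
    using c unfolding realizes_def by auto
  have "realizes c' A (\<lambda>q. b (g q))" unfolding realizes_def
  proof (intro conjI allI impI ballI)
    show "mono (\<lambda>q. b (g q))" by (intro monoI) (simp add: le monoD[OF \<open>mono b\<close>])
    show "surj (\<lambda>q. b (g q))"
    proof (rule surjI[of _ "\<lambda>\<sigma>. h (inv b \<sigma>)"])
      show "b (g (h (inv b \<sigma>))) = \<sigma>" for \<sigma> using \<open>surj b\<close> by (simp add: hg surj_f_inv_f)
    qed
    show "c' q \<in> A (b (g q))" for q using bc[of "g q"] by (simp add: cg)
    show "\<exists>r>q. b (g r) = b (g q)" for q
    proof -
      obtain r where "g q < r" "b r = b (g q)" using rb by blast
      then show ?thesis using less[of q "h r"] by (intro exI[of _ "h r"]) (simp add: hg)
    qed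
    fix p r k assume "p < r" "b (g p) = b (g r)" "k \<in> A (b (g p))"
    then obtain t where "g p < t" "t < g r" "c t = k" using realizes_dense[OF c, of "g p" "g r" k] less by blast
    then show "\<exists>t>p. t < r \<and> c' t = k" using less[of p "h t"] less[of "h t" r]
      by (intro exI[of _ "h t"]) (simp add: hg cg)
  qed
  then show ?thesis by blast
qed

lemma (in closed_code) invariant_coded:
  assumes "\<And>x i. x \<in> E \<Longrightarrow> x i \<le> 1"
  shows "invariant_under rat_coloring_iso (coded C E)"
  unfolding invariant_under_def
proof (intro allI impI)
  fix c c' assume c: "c \<in> coded C E" "(c, c') \<in> rat_coloring_iso"
  obtain b where "realizes c (block_colours C (decode c)) b" using realizes_of_coded(2)[OF c(1)] by blast
  from realizes_iso[OF this c(2)] obtain b' where "realizes c' (block_colours C (decode c)) b'" ..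
  with assms[OF realizes_of_coded(1)[OF c(1)]] realizes_of_coded(1)[OF c(1)]
  show "c' \<in> coded C E" by (rule coded_of_realizes)
qed

lemma measurable_eval_nat [measurable (raw)]:
  fixes f :: "'a \<Rightarrow> 'i::countable \<Rightarrow> nat"
  assumes "f \<in> borel_measurable M"
  shows "(\<lambda>x. f x i) \<in> M \<rightarrow>\<^sub>M count_space UNIV"
  using measurable_product_then_coordinatewise[OF assms, of i]
    measurable_cong_sets[OF refl sets_borel_eq_count_space[where 'a = nat]] by blast

lemma measurable_into_fun_nat:
  fixes f :: "'a \<Rightarrow> 'i::countable \<Rightarrow> nat"
  assumes "\<And>i. (\<lambda>x. f x i) \<in> M \<rightarrow>\<^sub>M count_space UNIV"
  shows "f \<in> borel_measurable M"
proof (rule measurable_coordinatewise_then_product)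
  show "(\<lambda>x. f x i) \<in> borel_measurable M" for i
    using assms[of i] measurable_cong_sets[OF refl sets_borel_eq_count_space[where 'a = nat]] by blast
qed

lemma pred_germ [measurable]: "Measurable.pred borel (\<lambda>c. germ c q \<sigma>)"
  unfolding germ_def by measurable

lemma decode_measurable [measurable]: "decode \<in> borel_measurable borel"
proof (rule measurable_into_fun_nat)
  show "(\<lambda>c. decode c n) \<in> borel \<rightarrow>\<^sub>M count_space UNIV" for n
    unfolding decode_def by measurable
qed

lemma pred_block_colours:
  assumes [measurable]: "f \<in> borel_measurable M"
  shows "Measurable.pred M (\<lambda>z. k \<in> block_colours C (f z) \<sigma>)"
proof -
  have "linked C (length \<sigma>) u x \<beta> \<longleftrightarrow>
      (\<exists>v. (\<forall>i<length \<sigma>. x i = v ! i) \<and> linked C (length \<sigma>) u ((!) v) \<beta>)" if "\<sigma> \<noteq> []" for u x \<beta>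
  proof
    have eq: "linked C (length \<sigma>) u x \<beta> \<longleftrightarrow> linked C (length \<sigma>) u ((!) v) \<beta>" if "\<forall>i<length \<sigma>. x i = v ! i" for v
      using \<open>\<sigma> \<noteq> []\<close> that by (intro linked_cong) (auto simp: agree_def)
    show "\<exists>v. (\<forall>i<length \<sigma>. x i = v ! i) \<and> linked C (length \<sigma>) u ((!) v) \<beta>" if "linked C (length \<sigma>) u x \<beta>"
      using eq[of "map x [0..<length \<sigma>]"] that by (intro exI[of _ "map x [0..<length \<sigma>]"]) simp
    show "linked C (length \<sigma>) u x \<beta>" if "\<exists>v. (\<forall>i<length \<sigma>. x i = v ! i) \<and> linked C (length \<sigma>) u ((!) v) \<beta>"
      using that eq by blast
  qed
  then have "k \<in> block_colours C x \<sigma> \<longleftrightarrow> (\<exists>\<tau>. k = marker \<tau> \<and> list_all2 (\<le>) \<tau> \<sigma>) \<or>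
     (\<exists>u v. (\<forall>i<length \<sigma>. x i = v ! i) \<and> k = label u \<and> \<sigma> \<noteq> [] \<and> length u = length \<sigma> \<and>
        linked C (length \<sigma>) ((!) u) ((!) v) ((!) \<sigma>))" for x
    unfolding block_colours_def by blast
  then show ?thesis by simp
qed

lemma coded_measurable:
  assumes [measurable]: "E \<in> sets borel"
  shows "coded C E \<in> sets borel"
proof -
  note pred_block_colours[measurable]
  show ?thesis unfolding coded_def by measurable
qed

section \<open>Invariant universality\<close>

lemma reducible_to_coded:
  fixes e :: "'a \<Rightarrow> nat \<Rightarrow> nat"
  assumes "closed_code C" and e [measurable]: "e \<in> borel_measurable N" and le: "\<And>x i. e x i \<le> 1"
    and R: "\<And>x y. x \<in> space N \<Longrightarrow> y \<in> space N \<Longrightarrow> (x, y) \<in> R \<longleftrightarrow> (\<exists>\<alpha>. (e x, e y, \<alpha>) \<in> C)"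
  shows "borel_reducible N R (restrict_space borel (coded C (e ` space N)))
    (rat_coloring_embed \<inter> coded C (e ` space N) \<times> coded C (e ` space N))"
proof -
  interpret closed_code C by fact
  define h where "h x = colouring (block_colours C (e x)) marker" for x
  have real: "realizes (h x) (block_colours C (e x)) cf_block" for x
    unfolding h_def using marker_self_in_block_colours by (rule realizes_colouring)
  have mem: "h x \<in> coded C (e ` space N)" if "x \<in> space N" for x
    using le _ real by (rule coded_of_realizes) (use that in blast)
  have "h \<in> borel_measurable N"
  proof (rule measurable_into_fun_nat)
    fix q
    have [measurable]: "Measurable.pred N (\<lambda>x. k \<in> block_colours C (e x) \<sigma>)" for k \<sigma>
      by (rule pred_block_colours[OF e])
    show "(\<lambda>x. h x q) \<in> N \<rightarrow>\<^sub>M count_space UNIV"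
      unfolding h_def colouring_def by measurable
  qed
  then have "h \<in> N \<rightarrow>\<^sub>M restrict_space borel (coded C (e ` space N))"
    by (intro measurable_restrict_space2) (use mem in auto)
  moreover have "(x, y) \<in> R \<longleftrightarrow> (h x, h y) \<in> rat_coloring_embed \<inter> coded C (e ` space N) \<times> coded C (e ` space N)"
    if "x \<in> space N" "y \<in> space N" for x y
    using R[OF that] embed_iff_code[OF le le real real, of x y] mem that by simp
  ultimately show ?thesis unfolding borel_reducible_def by (intro bexI[of _ h]) simp_all
qed

lemma coded_reducible:
  fixes e :: "'a \<Rightarrow> nat \<Rightarrow> nat"
  assumes "closed_code C" and le: "\<And>x i. e x i \<le> 1"
    and inj: "inj_on e (space N)" and pb: "pulls_back N e borel"
    and R: "\<And>x y. x \<in> space N \<Longrightarrow> y \<in> space N \<Longrightarrow> (x, y) \<in> R \<longleftrightarrow> (\<exists>\<alpha>. (e x, e y, \<alpha>) \<in> C)"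
  shows "borel_reducible (restrict_space borel (coded C (e ` space N)))
    (rat_coloring_embed \<inter> coded C (e ` space N) \<times> coded C (e ` space N)) N R"
proof -
  interpret closed_code C by fact
  let ?B = "coded C (e ` space N)"
  define r where "r c = the_inv_into (space N) e (decode c)" for c
  have r: "r c \<in> space N" "e (r c) = decode c" if "c \<in> ?B" for c
    using realizes_of_coded(1)[OF that] inj
    by (simp_all add: r_def the_inv_into_into f_the_inv_into_f)
  have "r \<in> restrict_space borel ?B \<rightarrow>\<^sub>M N"
  proof (rule measurableI)
    show "r c \<in> space N" if "c \<in> space (restrict_space borel ?B)" for c
      using that r(1) by (simp add: space_restrict_space)
    fix A assume "A \<in> sets N"
    then obtain D where D: "D \<in> sets borel" "\<forall>x\<in>space N. x \<in> A \<longleftrightarrow> e x \<in> D"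
      using pb unfolding pulls_back_def by blast
    have "r -` A \<inter> space (restrict_space borel ?B) = ?B \<inter> (decode -` D \<inter> space borel)"
      using D(2) r by (auto simp: space_restrict_space)
    moreover have "decode -` D \<inter> space borel \<in> sets borel"
      using decode_measurable D(1) by (rule measurable_sets)
    ultimately show "r -` A \<inter> space (restrict_space borel ?B) \<in> sets (restrict_space borel ?B)"
      unfolding sets_restrict_space by blast
  qed
  moreover have "(c, c') \<in> rat_coloring_embed \<inter> ?B \<times> ?B \<longleftrightarrow> (r c, r c') \<in> R"
    if c: "c \<in> ?B" "c' \<in> ?B" for c c'
  proof -
    obtain b where b: "realizes c (block_colours C (decode c)) b" using realizes_of_coded(2)[OF c(1)] by blast
    obtain b' where b': "realizes c' (block_colours C (decode c')) b'" using realizes_of_coded(2)[OF c(2)] by blast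
    have "decode c i \<le> 1" "decode c' i \<le> 1" for i
      using r(2)[OF c(1)] r(2)[OF c(2)] le by metis+
    from embed_iff_code[OF this b b'] show ?thesis using R[OF r(1)[OF c(1)] r(1)[OF c(2)]] r(2) c by simp
  qed
  ultimately show ?thesis unfolding borel_reducible_def
    by (intro bexI[of _ r]) (simp_all add: space_restrict_space)
qed

definition decode_map :: "(nat \<Rightarrow> nat) \<Rightarrow> rat \<Rightarrow> rat" where
  "decode_map \<gamma> q = from_nat (\<gamma> (to_nat q))"

lemma surj_decode_map: "\<exists>\<gamma>. decode_map \<gamma> = g"
  by (rule exI[of _ "\<lambda>n. to_nat (g (from_nat n))"]) (simp add: decode_map_def fun_eq_iff)

lemma measurable_decode_map [measurable (raw)]:
  assumes "f \<in> borel_measurable M"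
  shows "(\<lambda>z. decode_map (f z) q) \<in> M \<rightarrow>\<^sub>M count_space UNIV"
  unfolding decode_map_def
  by (rule measurable_compose[OF measurable_eval_nat[OF assms]]) simp

lemma analytic_colouring_relation:
  fixes P :: "(rat \<Rightarrow> rat) \<Rightarrow> bool"
  assumes "Measurable.pred borel (\<lambda>\<gamma>. P (decode_map \<gamma>))"
  shows "analytic_in (borel \<Otimes>\<^sub>M borel)
    {(c, c' :: rat \<Rightarrow> nat). \<exists>g. P g \<and> (\<forall>q. c q = (c' (g q) :: nat))}"
proof -
  define B where "B = {z :: ((rat \<Rightarrow> nat) \<times> (rat \<Rightarrow> nat)) \<times> (nat \<Rightarrow> nat).
    P (decode_map (snd z)) \<and> (\<forall>q. \<exists>p k. decode_map (snd z) q = p \<and> fst (fst z) q = k \<and> snd (fst z) p = k)}"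
  have [measurable]: "Measurable.pred ((borel \<Otimes>\<^sub>M borel) \<Otimes>\<^sub>M borel)
      (\<lambda>z :: ((rat \<Rightarrow> nat) \<times> (rat \<Rightarrow> nat)) \<times> (nat \<Rightarrow> nat). P (decode_map (snd z)))"
    by (rule measurable_compose[OF measurable_snd assms])
  have [measurable]:
    "(\<lambda>z :: ((rat \<Rightarrow> nat) \<times> (rat \<Rightarrow> nat)) \<times> (nat \<Rightarrow> nat). fst (fst z) q)
      \<in> (borel \<Otimes>\<^sub>M borel) \<Otimes>\<^sub>M borel \<rightarrow>\<^sub>M count_space UNIV"
    "(\<lambda>z :: ((rat \<Rightarrow> nat) \<times> (rat \<Rightarrow> nat)) \<times> (nat \<Rightarrow> nat). snd (fst z) q)
      \<in> (borel \<Otimes>\<^sub>M borel) \<Otimes>\<^sub>M borel \<rightarrow>\<^sub>M count_space UNIV"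
    "(\<lambda>z :: ((rat \<Rightarrow> nat) \<times> (rat \<Rightarrow> nat)) \<times> (nat \<Rightarrow> nat). decode_map (snd z) q)
      \<in> (borel \<Otimes>\<^sub>M borel) \<Otimes>\<^sub>M borel \<rightarrow>\<^sub>M count_space UNIV" for q
    by (intro measurable_eval_nat measurable_decode_map
        measurable_compose[OF measurable_fst measurable_fst]
        measurable_compose[OF measurable_fst measurable_snd] measurable_snd)+
  have "Measurable.pred ((borel \<Otimes>\<^sub>M borel) \<Otimes>\<^sub>M borel) (\<lambda>z :: ((rat \<Rightarrow> nat) \<times> (rat \<Rightarrow> nat)) \<times> (nat \<Rightarrow> nat).
    P (decode_map (snd z)) \<and> (\<forall>q. \<exists>p k. decode_map (snd z) q = p \<and> fst (fst z) q = k \<and> snd (fst z) p = k))"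
    by measurable
  then have "B \<in> sets ((borel \<Otimes>\<^sub>M borel) \<Otimes>\<^sub>M borel)"
    by (simp add: B_def pred_def space_pair_measure)
  moreover have "{(c, c' :: rat \<Rightarrow> nat). \<exists>g. P g \<and> (\<forall>q. c q = c' (g q))} = fst ` B"
  proof (intro set_eqI iffI)
    fix p :: "(rat \<Rightarrow> nat) \<times> (rat \<Rightarrow> nat)"
    assume "p \<in> {(c, c'). \<exists>g. P g \<and> (\<forall>q. c q = c' (g q))}"
    then obtain g where g: "P g" "\<forall>q. fst p q = snd p (g q)" by auto
    obtain \<gamma> where "decode_map \<gamma> = g" using surj_decode_map by blast
    then have "(p, \<gamma>) \<in> B" using g by (simp add: B_def)
    then show "p \<in> fst ` B" by force
  next
    fix p assume "p \<in> fst ` B"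
    then obtain \<gamma> where "(p, \<gamma>) \<in> B" by auto
    then show "p \<in> {(c, c'). \<exists>g. P g \<and> (\<forall>q. c q = c' (g q))}"
      by (auto simp: B_def case_prod_unfold)
  qed
  ultimately show ?thesis unfolding analytic_in_def by blast
qed

lemma pred_strict_mono_decode: "Measurable.pred borel (\<lambda>\<gamma>. strict_mono (decode_map \<gamma>))"
proof -
  have "Measurable.pred borel (\<lambda>\<gamma>. \<forall>q r. q < r \<longrightarrow> decode_map \<gamma> q < decode_map \<gamma> r)"
    by measurable
  then show ?thesis by (simp add: strict_mono_def monotone_on_def)
qed

lemma strict_mono_bij_iff: "bij h \<and> strict_mono h \<longleftrightarrow> surj h \<and> strict_mono h" for h :: "rat \<Rightarrow> rat"
  by (auto simp: bij_def strict_mono_imp_inj_on)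

lemma analytic_embed: "analytic_in (borel \<Otimes>\<^sub>M borel) rat_coloring_embed"
  unfolding rat_coloring_embed_def
  by (rule analytic_colouring_relation) (rule pred_strict_mono_decode)

lemma analytic_iso: "analytic_in (borel \<Otimes>\<^sub>M borel) rat_coloring_iso"
proof -
  note pred_strict_mono_decode[measurable]
  have "Measurable.pred borel (\<lambda>\<gamma>. (\<forall>p. \<exists>q. p = decode_map \<gamma> q) \<and> strict_mono (decode_map \<gamma>))"
    by measurable
  then have "Measurable.pred borel (\<lambda>\<gamma>. bij (decode_map \<gamma>) \<and> strict_mono (decode_map \<gamma>))"
    unfolding strict_mono_bij_iff surj_def .
  from analytic_colouring_relation[OF this] show ?thesis
    unfolding rat_coloring_iso_def by (simp only: conj_assoc)
qed

lemma rat_coloring_embed_preorder: "preorder_on UNIV rat_coloring_embed"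
proof -
  have "(c, c) \<in> rat_coloring_embed" for c
    unfolding rat_coloring_embed_def by (auto intro!: exI[of _ "\<lambda>q. q"] strict_monoI)
  moreover have "(c, c'') \<in> rat_coloring_embed"
    if "(c, c') \<in> rat_coloring_embed" "(c', c'') \<in> rat_coloring_embed" for c c' c''
  proof -
    obtain g g' where "strict_mono g" "strict_mono g'" "\<forall>q. c q = c' (g q)" "\<forall>q. c' q = c'' (g' q)"
      using \<open>(c, c') \<in> rat_coloring_embed\<close> \<open>(c', c'') \<in> rat_coloring_embed\<close>
      unfolding rat_coloring_embed_def by blast
    then show ?thesis unfolding rat_coloring_embed_def
      by (intro CollectI case_prodI exI[of _ "\<lambda>q. g' (g q)"]) (auto simp: strict_mono_def)
  qed
  ultimately show ?thesis unfolding preorder_on_def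
    by (intro conjI refl_onI transI) auto
qed

lemma rat_coloring_iso_equiv: "equiv UNIV rat_coloring_iso"
proof (rule equivI)
  show "refl rat_coloring_iso"
    by (rule refl_onI) (auto simp: rat_coloring_iso_def intro!: exI[of _ "\<lambda>q. q"] strict_monoI bij_id[unfolded id_def])
  show "sym rat_coloring_iso"
  proof (rule symI)
    fix c c' assume "(c, c') \<in> rat_coloring_iso"
    then obtain h where h: "bij h" "strict_mono h" "\<forall>q. c q = c' (h q)"
      unfolding rat_coloring_iso_def by blast
    have hi: "h (inv h q) = q" for q using h(1) by (simp add: bij_is_surj surj_f_inv_f)
    have "strict_mono (inv h)"
      by (rule strict_monoI) (use strict_mono_less[OF h(2)] hi in metis)
    moreover have "bij (inv h)" using h(1) by (rule bij_imp_bij_inv)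
    moreover have "\<forall>q. c' q = c (inv h q)" using h(3) hi by simp
    ultimately show "(c', c) \<in> rat_coloring_iso" unfolding rat_coloring_iso_def by blast
  qed
  show "trans rat_coloring_iso"
  proof (rule transI)
    fix c c' c'' assume "(c, c') \<in> rat_coloring_iso" "(c', c'') \<in> rat_coloring_iso"
    then obtain h h' where "bij h" "strict_mono h" "\<forall>q. c q = c' (h q)"
      "bij h'" "strict_mono h'" "\<forall>q. c' q = c'' (h' q)"
      unfolding rat_coloring_iso_def by blast
    then show "(c, c'') \<in> rat_coloring_iso" unfolding rat_coloring_iso_def
      by (intro CollectI case_prodI exI[of _ "h' \<circ> h"]) (auto simp: strict_mono_def intro: bij_comp)
  qed
qed simp

lemma rat_coloring_iso_embed: "rat_coloring_iso \<subseteq> rat_coloring_embed \<inter> rat_coloring_embed\<inverse>"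
proof -
  have "rat_coloring_iso \<subseteq> rat_coloring_embed"
    unfolding rat_coloring_iso_def rat_coloring_embed_def by blast
  moreover have "sym rat_coloring_iso" using rat_coloring_iso_equiv by (simp add: equiv_def)
  ultimately show ?thesis by (auto dest: symD)
qed

theorem theorem5p10:
  shows "invariantly_universal TYPE('b) (borel :: (rat \<Rightarrow> nat) measure)
           rat_coloring_embed rat_coloring_iso"
  unfolding invariantly_universal_def
proof (intro conjI allI impI)
  show "standard_borel (borel :: (rat \<Rightarrow> nat) measure)" by (rule standard_borel_fun_nat)
  show "analytic_quasi_order borel rat_coloring_embed"
    by (simp add: analytic_quasi_order_def rat_coloring_embed_preorder analytic_embed)
  show "analytic_equivalence borel rat_coloring_iso"
    by (simp add: analytic_equivalence_def rat_coloring_iso_equiv analytic_iso)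
  show "rat_coloring_iso \<subseteq> rat_coloring_embed \<inter> rat_coloring_embed\<inverse>"
    by (rule rat_coloring_iso_embed)
  fix N :: "'b measure" and R
  assume "standard_borel N" "analytic_quasi_order N R"
  then obtain e :: "'b \<Rightarrow> nat \<Rightarrow> nat" and C :: "((nat \<Rightarrow> nat) \<times> (nat \<Rightarrow> nat) \<times> (nat \<Rightarrow> nat)) set"
    where e: "e \<in> borel_measurable N" "\<And>x i. e x i \<le> 1"
    "inj_on e (space N)" "e ` space N \<in> sets borel" "pulls_back N e borel" and C: "closed_code C"
    and R: "\<And>x y. x \<in> space N \<Longrightarrow> y \<in> space N \<Longrightarrow> (x, y) \<in> R \<longleftrightarrow> (\<exists>\<alpha>. (e x, e y, \<alpha>) \<in> C)"
    by (rule closed_code_of_analytic) (rule that)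
  show "\<exists>B\<in>sets borel. invariant_under rat_coloring_iso B \<and>
      borel_bireducible N R (restrict_space borel B) (rat_coloring_embed \<inter> B \<times> B)"
  proof (intro bexI[of _ "coded C (e ` space N)"] conjI)
    show "invariant_under rat_coloring_iso (coded C (e ` space N))"
      using C by (rule closed_code.invariant_coded) (use e(2) in blast)
    show "borel_bireducible N R (restrict_space borel (coded C (e ` space N)))
        (rat_coloring_embed \<inter> coded C (e ` space N) \<times> coded C (e ` space N))"
      unfolding borel_bireducible_def
      using reducible_to_coded[OF C e(1,2) R] coded_reducible[OF C e(2,3,5) R] by blast
    show "coded C (e ` space N) \<in> sets borel" using e(4) by (rule coded_measurable)
  qed
qed

end
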